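(* Let $n\in\mathbb{C}\setminus\{0,-\tfrac12,-1,-\tfrac32,-2\}$, $p,p'\in\mathbb{Z}_2$, $\lambda,\mu,\lambda',\mu'\in\mathbb{C}$, $\delta=\mu-\lambda$, $\delta'=\mu'-\lambda'$. The SVC is necessary for $\mathrm{SQ}^{\delta-n,p,6}_{\lambda,\mu}\cong\mathrm{SQ}^{\delta'-n,p',6}_{\lambda',\mu'}$. Moreover: (i) Suppose $p=p'=0$. If $\delta-n$ or $\delta'-n$ lies in $\{0,1,2\}$, or if at least one of $B^0_{n+5/2,n}$, $B^1_{n+2,n+1/2}$, $B^1_{n+5/2,n+1/2}$, $B^0_{n+2,n}$ vanishes at $(\gamma,\delta)$ or at $(\gamma',\delta')$, then the SVC is also sufficient for equivalence. Otherwise the subquotients are equivalent if and only if they satisfy the SVC and $I^0_n(\gamma,\delta)=I^0_n(\gamma',\delta')$. (ii) Suppose $p=p'=1$. If $\delta-n$ or $\delta'-n$ lies in $\{\tfrac12,\tfrac32\}$, or if at least one of $B^1_{n+5/2,n}$, $B^0_{n+2,n+1/2}$, $B^0_{n+5/2,n+1/2}$, $B^1_{n+2,n}$ vanishes at $(\gamma,\delta)$ or at $(\gamma',\delta')$, then the SVC is also sufficient. Otherwise the subquotients are equivalent if and only if they satisfy the SVC and $I^1_n(\gamma,\delta)=I^1_n(\gamma',\delta')$. (iii) Suppose $p=0$, $p'=1$. If $S^0_{i,j}(\gamma,\delta)=0$ or $S^1_{i,j}(\gamma',\delta')=0$ for at least one $(i,j)\in\{(\tfrac52,0),(2,\tfrac12),(\tfrac52,\tfrac12),(2,0)\}$,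 then the SVC is also sufficient. Otherwise the subquotients are equivalent if and only if they satisfy the SVC and $I^0_n(\gamma,\delta)=I^1_n(\gamma',\delta')$.
   Context: Work over $\mathbb{C}$ on the superline $\mathbb{R}^{1|1}$ in the polynomial category. Let $\mathbb{C}[x,\xi]$ be the polynomial superalgebra with even $x$ and odd $\xi$ ($\xi^2=0$), $D=\partial_\xi+\xi\partial_x$, $\bar D=\partial_\xi-\xi\partial_x$; $X_F=F\partial_x+\tfrac12 D(F)\bar D$ for $F\in\mathbb{C}[x,\xi]$, and $\mathcal{K}=\{X_F\}$ (contact vector fields). $V^{p\Pi}$ is $V$ for $p$ even and $V$ with parity reversed for $p$ odd. For $\nu\in\mathbb{C}$, $\mathcal{F}_\nu=\alpha^\nu\mathbb{C}[x,\xi]$ ($\alpha^\nu$ formal, even), $L_\nu(X_F)(\alpha^\nu G)=\alpha^\nu(X_F(G)+\nu\,\partial_x(F)\,G)$. For $z\in\mathbb{C}$, $\bar D^z_0=e^{i\pi z/2}\partial_x^{z/2}$ (even), $\bar D^z_1=e^{i\pi(z-1)/2}\partial_x^{(z-1)/2}\bar D$ (odd). For $\lambda,\mu,k\in\mathbb{C}$, $p\in\mathbb{Z}_2$, $\delta=\mu-\lambda$: $\Psi^{k,p}_{\lambda,\mu}=\{\alpha^{\delta}\sum_{j\in\mathbb{N}}T_{2k-j}\bar D^{2k-j}_{p+(j\bmod 2)}:T_{2k-j}\in\mathbb{C}[x,\xi]\}$ (formal series), composition via $\bar D^{z'}_{p'}\circ\bar D^z_p=\bar D^{z+z'}_{p+p'}$,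 $[\bar D,\partial_x^z]=0$, $\partial_x^z\circ F=\sum_{j}\binom{z}{j}\partial_x^j(F)\circ\partial_x^{z-j}$, and $\mathcal{K}$-action $L_{\lambda,\mu}(X)(T)=L_\mu(X)\circ T-(-1)^{|X||T|}T\circ L_\lambda(X)$. $\mathrm{SQ}^{k,p,l}_{\lambda,\mu}=\Psi^{k,p}_{\lambda,\mu}/\Psi^{k-l/2,\,p+l}_{\lambda,\mu}$ ($l\in\mathbb{Z}^+$); $\cong$ is $\mathcal{K}$-equivalence of any parity. Set $\gamma^{1/2}=\sqrt3(\lambda+\mu-\tfrac12)$, $\gamma=(\gamma^{1/2})^2$, $\gamma^{3/2}=\gamma\gamma^{1/2}$, and similarly $\gamma',\delta'$ for $(\lambda',\mu')$. For $m\in\mathbb{C}$ define functions of $(\gamma,\delta)$ (the superscript $q$ of $B^q_{a,b}$ is read mod 2; subscripts $(a,b)$ mean $m=b$, $r=a-b$): $B^0_{m+3/2,m}=\gamma^{1/2}$; $B^1_{m+3/2,m}=\gamma-3(m+\tfrac12)\delta-\tfrac34$; $B^0_{m+2,m}=\gamma-(m+\tfrac32)(2\delta+m+\tfrac12)$; $B^1_{m+2,m}=\gamma-m(2\delta+m+1)$; $B^0_{m+5/2,m}=\gamma-(m+1)\delta-\tfrac34$; $B^1_{m+5/2,m}=\gamma^{3/2}-\gamma^{1/2}[4(m+1)\delta-(m+1)^2+3]$. Let $(x)_r=x(x-1)\cdots(x-r+1)$, $(x)_0=1$, $\{j\}=j-\lfloor j\rfloor$. For $i,j\in\tfrac12\mathbb{N}$: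 $S^0_{i,j}(\gamma,\delta)=(\delta-n-\lceil j\rceil)_{\lceil i\rceil-\lceil j\rceil}\,B^{2\{j\}}_{n+i,n+j}(\gamma,\delta)$ and $S^1_{i,j}(\gamma,\delta)=(\delta-n-\tfrac12-\lfloor j\rfloor)_{\lfloor i\rfloor-\lfloor j\rfloor}\,B^{1-2\{j\}}_{n+i,n+j}(\gamma,\delta)$. $\mathrm{SQ}^{\delta-n,p,l}_{\lambda,\mu}$ and $\mathrm{SQ}^{\delta'-n,p',l}_{\lambda',\mu'}$ satisfy the SVC (simultaneous vanishing condition) if for all $i,j\in\tfrac12\mathbb{N}$ with $i\le\tfrac12(l-1)$ and $\tfrac32\le i-j\le\tfrac52$, $S^p_{i,j}(\gamma,\delta)$ and $S^{p'}_{i,j}(\gamma',\delta')$ are both zero or both nonzero. Finally, for $p\in\{0,1\}$, $I^p_n=\dfrac{B^p_{n+5/2,n}\,B^{p+1}_{n+2,n+1/2}}{B^{p+1}_{n+5/2,n+1/2}\,B^p_{n+2,n}}$ (a function of $(\gamma,\delta)$). *)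

theory Defs
  imports "HOL-Computational_Algebra.Polynomial" "HOL-Library.Product_Plus" Complex_Main
begin

text \<open>An element a + xi*b of C[x,xi] (x even, xi odd, xi^2 = 0) is the pair (a,b) of complex
polynomials in x.  Addition, subtraction, negation and zero are componentwise (Product_Plus).\<close>

type_synonym spoly = "complex poly \<times> complex poly"

definition sp_mult :: "spoly \<Rightarrow> spoly \<Rightarrow> spoly" where
  "sp_mult F G = (fst F * fst G, snd F * fst G + fst F * snd G)"

definition sp_smult :: "complex \<Rightarrow> spoly \<Rightarrow> spoly" where
  "sp_smult c F = (smult c (fst F), smult c (snd F))"

definition sp_dx :: "spoly \<Rightarrow> spoly" where
  "sp_dx F = (pderiv (fst F), pderiv (snd F))"

definition sp_dxi :: "spoly \<Rightarrow> spoly" where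
  "sp_dxi F = (snd F, 0)"

definition sp_ximul :: "spoly \<Rightarrow> spoly" where
  "sp_ximul F = (0, fst F)"

definition sp_D :: "spoly \<Rightarrow> spoly" where
  "sp_D F = sp_dxi F + sp_ximul (sp_dx F)"

definition sp_Dbar :: "spoly \<Rightarrow> spoly" where
  "sp_Dbar F = sp_dxi F - sp_ximul (sp_dx F)"

definition sp_sigma :: "spoly \<Rightarrow> spoly" where
  "sp_sigma F = (fst F, - snd F)"

definition sp_deg :: "spoly \<Rightarrow> nat" where
  "sp_deg F = max (degree (fst F)) (degree (snd F))"

definition sp_homog :: "bool \<Rightarrow> spoly \<Rightarrow> bool" where  \<comment> \<open>True = odd\<close>
  "sp_homog par F = (if par then fst F = 0 else snd F = 0)"

text \<open>A term (T, z, q) stands for the operator T o Dbar^z_q (q = True means odd subscript 1);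
a symbol is a finite formal sum (list) of such terms.  The density factor alpha^delta is
implicit.\<close>

type_synonym sterm = "spoly \<times> complex \<times> bool"
type_synonym symb = "sterm list"

definition sym_lmul :: "spoly \<Rightarrow> symb \<Rightarrow> symb" where
  "sym_lmul G S = map (\<lambda>(T,z,q). (sp_mult G T, z, q)) S"

definition sym_scale :: "complex \<Rightarrow> symb \<Rightarrow> symb" where
  "sym_scale c S = map (\<lambda>(T,z,q). (sp_smult c T, z, q)) S"

text \<open>Right composition with Dbar^w_r, using Dbar^w_r o ... i.e. Dbar^z_q o Dbar^w_r = Dbar^(z+w)_(q+r).\<close>
definition sym_rcomp_dbar :: "symb \<Rightarrow> complex \<Rightarrow> bool \<Rightarrow> symb" where
  "sym_rcomp_dbar S w r = map (\<lambda>(T,z,q). (T, z + w, q \<noteq> r)) S"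

text \<open>Dbar^z_q o G for a superpolynomial G, obtained from
  partial_x^s o G = sum_j (s choose j) partial_x^j(G) o partial_x^(s-j),
  Dbar o G = Dbar(G) + (-1)^|G| G o Dbar, and the definitions of Dbar^z_0, Dbar^z_1
  (the exponential prefactors give the sign (-1)^j).\<close>
definition dbar_comp_poly :: "complex \<Rightarrow> bool \<Rightarrow> spoly \<Rightarrow> symb" where
  "dbar_comp_poly z q G =
    (if \<not> q then
       map (\<lambda>i. (sp_smult ((-1)^i * ((z/2) gchoose i)) ((sp_dx ^^ i) G),
                 z - 2 * of_nat i, False)) [0..<Suc (sp_deg G)]
     else
       map (\<lambda>i. (sp_smult ((-1)^i * (((z-1)/2) gchoose i)) ((sp_dx ^^ i) (sp_Dbar G)),
                 z - 1 - 2 * of_nat i, False)) [0..<Suc (sp_deg G)]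
     @ map (\<lambda>i. (sp_smult ((-1)^i * (((z-1)/2) gchoose i)) ((sp_dx ^^ i) (sp_sigma G)),
                 z - 2 * of_nat i, True)) [0..<Suc (sp_deg G)])"

text \<open>Composition of symbols: (A o Dbar^a_qa) o (B o Dbar^b_qb) = A o (Dbar^a_qa o B) o Dbar^b_qb.\<close>
definition sym_comp :: "symb \<Rightarrow> symb \<Rightarrow> symb" where
  "sym_comp S1 S2 = concat (map (\<lambda>(A,za,qa). concat (map (\<lambda>(B,zb,qb).
      sym_lmul A (sym_rcomp_dbar (dbar_comp_poly za qa B) zb qb)) S2)) S1)"

text \<open>L_nu(X_F) = F partial_x + 1/2 D(F) Dbar + nu partial_x(F), with partial_x = - Dbar^2_0,
Dbar = Dbar^1_1 and the identity = Dbar^0_0.\<close>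
definition LX :: "complex \<Rightarrow> spoly \<Rightarrow> symb" where
  "LX nu F = [(- F, 2, False), (sp_smult (1/2) (sp_D F), 1, True),
              (sp_smult nu (sp_dx F), 0, False)]"

text \<open>The action L_{lam,mu}(X_F)(T) = L_mu(X_F) o T - (-1)^(|X||T|) T o L_lam(X_F), for F of parity
fpar, with T split into homogeneous terms (the term ((a,0),z,q) has parity q, the term
((0,b),z,q) parity not q).\<close>
definition act_hom :: "complex \<Rightarrow> complex \<Rightarrow> bool \<Rightarrow> spoly \<Rightarrow> symb \<Rightarrow> symb" where
  "act_hom lam mu fpar F S =
     sym_comp (LX mu F) S @
     concat (map (\<lambda>(T,z,q).
        sym_scale (if fpar \<and> q then 1 else -1) (sym_comp [((fst T, 0), z, q)] (LX lam F))
      @ sym_scale (if fpar \<and> \<not> q then 1 else -1) (sym_comp [((0, snd T), z, q)] (LX lam F))) S)"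

definition sym_act :: "complex \<Rightarrow> complex \<Rightarrow> spoly \<Rightarrow> symb \<Rightarrow> symb" where
  "sym_act lam mu F S = act_hom lam mu False (fst F, 0) S @ act_hom lam mu True (0, snd F) S"

definition sym_coef :: "symb \<Rightarrow> complex \<Rightarrow> bool \<Rightarrow> spoly" where
  "sym_coef S z q = sum_list (map (\<lambda>(T,z',q'). if z' = z \<and> q' = q then T else 0) S)"

section \<open>Subquotients SQ^{k,p,l}_{lam,mu} = Psi^{k,p}/Psi^{k-l/2,p+l}\<close>

text \<open>An element is represented by its coefficients T j = T_{2k-j}, j < l, of
Dbar^{2k-j}_{p + (j mod 2)} (coefficients with j \<ge> l are zero).\<close>

definition sq_carrier :: "nat \<Rightarrow> (nat \<Rightarrow> spoly) set" where
  "sq_carrier l = {T. \<forall>j\<ge>l. T j = 0}"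

definition sq_sym :: "complex \<Rightarrow> bool \<Rightarrow> nat \<Rightarrow> (nat \<Rightarrow> spoly) \<Rightarrow> symb" where
  "sq_sym k p l T = map (\<lambda>j. (T j, 2 * k - of_nat j, p \<noteq> odd j)) [0..<l]"

definition sq_act :: "complex \<Rightarrow> complex \<Rightarrow> complex \<Rightarrow> bool \<Rightarrow> nat \<Rightarrow> spoly
                      \<Rightarrow> (nat \<Rightarrow> spoly) \<Rightarrow> (nat \<Rightarrow> spoly)" where
  "sq_act lam mu k p l F T =
     (\<lambda>j. if j < l then sym_coef (sym_act lam mu F (sq_sym k p l T)) (2 * k - of_nat j) (p \<noteq> odd j)
          else 0)"

definition sq_homog :: "bool \<Rightarrow> bool \<Rightarrow> (nat \<Rightarrow> spoly) \<Rightarrow> bool" where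
  "sq_homog p par T = (\<forall>j. sp_homog (par \<noteq> (p \<noteq> odd j)) (T j))"

definition SQ_equiv :: "nat \<Rightarrow> complex \<Rightarrow> complex \<Rightarrow> complex \<Rightarrow> bool
                        \<Rightarrow> complex \<Rightarrow> complex \<Rightarrow> complex \<Rightarrow> bool \<Rightarrow> bool" where
  "SQ_equiv l lam mu k p lam' mu' k' p' =
    (\<exists>(\<Phi> :: (nat \<Rightarrow> spoly) \<Rightarrow> (nat \<Rightarrow> spoly)) (r::bool).
       bij_betw \<Phi> (sq_carrier l) (sq_carrier l)
     \<and> (\<forall>T\<in>sq_carrier l. \<forall>U\<in>sq_carrier l. \<Phi> (\<lambda>j. T j + U j) = (\<lambda>j. \<Phi> T j + \<Phi> U j))
     \<and> (\<forall>c. \<forall>T\<in>sq_carrier l. \<Phi> (\<lambda>j. sp_smult c (T j)) = (\<lambda>j. sp_smult c (\<Phi> T j)))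
     \<and> (\<forall>par. \<forall>T\<in>sq_carrier l. sq_homog p par T \<longrightarrow> sq_homog p' (par \<noteq> r) (\<Phi> T))
     \<and> (\<forall>fpar F. \<forall>T\<in>sq_carrier l. sp_homog fpar F \<longrightarrow>
          \<Phi> (sq_act lam mu k p l F T)
          = (\<lambda>j. sp_smult (if r \<and> fpar then -1 else 1) (sq_act lam' mu' k' p' l F (\<Phi> T) j))))"

definition gam12 :: "complex \<Rightarrow> complex \<Rightarrow> complex" where
  "gam12 lam mu = complex_of_real (sqrt 3) * (lam + mu - 1/2)"

text \<open>Bf q s m g d = B^q_{m + s/2, m} evaluated at gamma^{1/2} = g (gamma = g^2), delta = d;
q = True means superscript 1 (mod 2); only s \<in> {3,4,5} occur.\<close>
definition Bf :: "bool \<Rightarrow> nat \<Rightarrow> complex \<Rightarrow> complex \<Rightarrow> complex \<Rightarrow> complex" where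
  "Bf q s m g d =
    (if s = 3 then (if \<not> q then g else g^2 - 3 * (m + 1/2) * d - 3/4)
     else if s = 4 then (if \<not> q then g^2 - (m + 3/2) * (2 * d + m + 1/2)
                         else g^2 - m * (2 * d + m + 1))
     else if s = 5 then (if \<not> q then g^2 - (m + 1) * d - 3/4
                         else g^3 - g * (4 * (m + 1) * d - (m + 1)^2 + 3))
     else 0)"

definition falling :: "complex \<Rightarrow> nat \<Rightarrow> complex" where
  "falling x r = (\<Prod>t<r. x - of_nat t)"

text \<open>Sf p n hi hj g d = S^p_{i,j}(gamma,delta) with i = hi/2, j = hj/2.\<close>
definition Sf :: "bool \<Rightarrow> complex \<Rightarrow> nat \<Rightarrow> nat \<Rightarrow> complex \<Rightarrow> complex \<Rightarrow> complex" where
  "Sf p n hi hj g d =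
    (if \<not> p then
       falling (d - n - of_nat ((hj + 1) div 2)) ((hi + 1) div 2 - (hj + 1) div 2)
         * Bf (odd hj) (hi - hj) (n + of_nat hj / 2) g d
     else
       falling (d - n - 1/2 - of_nat (hj div 2)) (hi div 2 - hj div 2)
         * Bf (\<not> odd hj) (hi - hj) (n + of_nat hj / 2) g d)"

text \<open>SVC for SQ^{delta-n,p,l}_{lam,mu} and SQ^{delta'-n,p',l}_{lam',mu'}, with i = hi/2, j = hj/2.\<close>
definition SVC :: "complex \<Rightarrow> nat \<Rightarrow> bool \<Rightarrow> complex \<Rightarrow> complex \<Rightarrow> bool \<Rightarrow> complex \<Rightarrow> complex \<Rightarrow> bool" where
  "SVC n l p g d p' g' d' =
    (\<forall>hi hj. hi + 1 \<le> l \<and> hj + 3 \<le> hi \<and> hi \<le> hj + 5 \<longrightarrow>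
       (Sf p n hi hj g d = 0 \<longleftrightarrow> Sf p' n hi hj g' d' = 0))"

definition Ifn :: "bool \<Rightarrow> complex \<Rightarrow> complex \<Rightarrow> complex \<Rightarrow> complex" where
  "Ifn p n g d = Bf p 5 n g d * Bf (\<not> p) 3 (n + 1/2) g d
                / (Bf (\<not> p) 4 (n + 1/2) g d * Bf p 4 n g d)"

definition Bvanish :: "bool \<Rightarrow> complex \<Rightarrow> complex \<Rightarrow> complex \<Rightarrow> bool" where
  "Bvanish p n g d = (Bf p 5 n g d = 0 \<or> Bf (\<not> p) 3 (n + 1/2) g d = 0
                      \<or> Bf (\<not> p) 4 (n + 1/2) g d = 0 \<or> Bf p 4 n g d = 0)"

end

(* The coefficient T_{2k-j} of a symbol is a density of weight n + j/2, and D = sigma Dbar satisfies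
   D^2 = d/dx.  In terms of the bidifferential operators F, G |-> D^a(F) sigma^a(D^b(G)) the contact
   vector field X_F acts on the coefficients by the density action plus, in each lower slot, a multiple
   of D^{s+2}(F) sigma^s(G).  For n outside {0,-1/2,-1,-3/2,-2} the osp(1|2)-equivariant (projective)
   quantization G |-> sum_s c_s D^s(G) turns this into a normal form in which the slots i and i+s are
   linked only for s = 3, 4, 5, by a scalar multiple of a fixed transvectant; up to a factor depending
   on n and the parity only, that scalar is S^p_{i+s/2,i/2}.  An equivalence must be diagonal on the
   constants of each slot, and comparing its values on the images of the constants under
   X_{xi x^2}, X_{x^3}, X_{xi x^3} shows that it rescales these scalars by b_{i+s}/b_i.  Since the six
   links form a graph on {0,...,5} with the single cycle 0-4-1-5-0, the only invariants are their
   vanishing and one cross ratio, which is I^p_n. *)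
theory Submission
  imports Defs
begin

section \<open>The action on subquotients in jet form\<close>

text \<open>The subalgebra osp(1|2) consists of the X_F with D^5(F) = 0, that is, F in the span of
  1, xi, x, xi x, x^2. Links equivariant under it must kill these F, hence start with D^5(F); since
  a link of length s has total order s + 2, lengths 1 and 2 cannot occur. Moreover F |-> D^5(F) is
  itself osp(1|2)-equivariant, from weight -1 to weight 3/2, and the links of length 3, 4, 5 are the
  supertransvectants of order 0, 1/2, 1 of D^5(F) with a density. The excluded n are the zeros of
  the denominators in the quantization coefficients. Expanding the intertwining relation in the
  basis D^a(F) sigma^a(D^b(G)) leaves, for six slots, finitely many identities between rational
  functions of the weight, delta and lambda. An equivalence is rigid because X_xi acts as D/2 in
  every slot, so that constants go to constants, and X_x acts on the constants of slot i by n + i/2,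
  which separates the slots. The invariants of different parities p can be compared directly because
  the constants relating the link scalars to S^p enter the cross ratio through a factor independent
  of p.\<close>

definition jet_prod :: "nat \<Rightarrow> nat \<Rightarrow> spoly \<Rightarrow> spoly \<Rightarrow> spoly" where
  "jet_prod a b F G = sp_mult ((sp_D ^^ a) F) ((sp_sigma ^^ a) ((sp_D ^^ b) G))"

text \<open>Since sigma D = Dbar and D^2 = d/dx, the three terms are F G', D(F) Dbar(G)/2 and nu F'
  G: the Lie derivative along X_F on nu-densities.\<close>

definition dens :: "complex \<Rightarrow> spoly \<Rightarrow> spoly \<Rightarrow> spoly" where
  "dens nu F G = jet_prod 0 2 F G + sp_smult (1/2) (jet_prod 1 1 F G) + sp_smult nu (jet_prod 2 0 F G)"

lemma sp_sigma_sigma [simp]: "sp_sigma (sp_sigma G) = G"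
  by (simp add: sp_sigma_def)

text \<open>The action adds to slot i + s the coefficient lower_coef lam z q s times D^(s+2)(F) sigma^s(T),
where T stands in slot i in front of Dbar^z_q.  The binomials come from Dbar^z_q o H, the sign from
rewriting Dbar-derivatives of F as D-derivatives.\<close>
definition lower_coef :: "complex \<Rightarrow> complex \<Rightarrow> bool \<Rightarrow> nat \<Rightarrow> complex" where
  "lower_coef lam z q s = (-1) ^ (s div 2) *
    (if \<not> q then
       if even s then - ((z/2 gchoose Suc (s div 2)) + lam * (z/2 gchoose (s div 2)))
       else (z/2 gchoose Suc (s div 2)) / 2
     else
       if even s then - (((z-1)/2 gchoose Suc (s div 2)) + (1/2 + lam) * ((z-1)/2 gchoose (s div 2)))
       else ((z-1)/2 gchoose Suc (s div 2)) / 2 + lam * ((z-1)/2 gchoose (s div 2)))"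

lemma sp_D_pair: "sp_D F = (snd F, pderiv (fst F))"
  by (simp add: sp_D_def sp_dxi_def sp_ximul_def sp_dx_def)

lemma sp_Dbar_pair: "sp_Dbar F = (snd F, - pderiv (fst F))"
  by (simp add: sp_Dbar_def sp_dxi_def sp_ximul_def sp_dx_def)

lemma sp_dx_funpow: "(sp_dx ^^ i) F = ((pderiv ^^ i) (fst F), (pderiv ^^ i) (snd F))"
  by (induction i) (auto simp: sp_dx_def)

lemma sp_D_funpow_even: "(sp_D ^^ (2 * i)) F = (sp_dx ^^ i) F"
  by (induction i) (auto simp: sp_dx_def sp_D_pair)

lemma sp_D_funpow_odd: "(sp_D ^^ Suc (2 * i)) F = (sp_dx ^^ i) (sp_D F)"
  by (simp only: funpow_Suc_right o_apply sp_D_funpow_even)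

lemma pderiv_funpow_0: "(pderiv ^^ i) 0 = (0 :: complex poly)"
  by (induction i) auto

lemma sp_dx_funpow_eq_0: "sp_deg F < i \<Longrightarrow> (sp_dx ^^ i) F = 0"
proof -
  have *: "(pderiv ^^ i) f = 0" if "degree f < i" for f :: "complex poly"
    using that
  proof (induction i arbitrary: f)
    case (Suc i)
    show ?case
    proof (cases "degree f = 0")
      case True
      then have "pderiv f = 0" by (simp add: pderiv_eq_0_iff)
      then show ?thesis by (simp add: funpow_Suc_right pderiv_funpow_0 del: funpow.simps(2))
    next
      case False
      then have "degree (pderiv f) < i" using Suc.prems by (simp add: degree_pderiv)
      then show ?thesis by (simp add: funpow_Suc_right Suc.IH del: funpow.simps(2))
    qed
  qed simp
  assume "sp_deg F < i"
  then show ?thesis by (simp add: sp_dx_funpow * sp_deg_def zero_prod_def)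
qed

lemma sp_smult_0 [simp]: "sp_smult c 0 = 0" "sp_smult 0 F = 0"
  by (simp_all add: sp_smult_def zero_prod_def)

lemma sp_mult_0 [simp]: "sp_mult 0 F = 0" "sp_mult F 0 = 0"
  by (simp_all add: sp_mult_def zero_prod_def)

lemma sp_mult_add: "sp_mult F (G + H) = sp_mult F G + sp_mult F H"
  "sp_mult (F + G) H = sp_mult F H + sp_mult G H"
  by (simp_all add: sp_mult_def algebra_simps)

lemma sp_smult_add: "sp_smult c (G + H) = sp_smult c G + sp_smult c H"
  by (simp add: sp_smult_def smult_add_right)

section \<open>Coefficients of composed symbols\<close>

lemma sym_coef_simps [simp]:
  "sym_coef [] z q = 0"
  "sym_coef (S1 @ S2) z q = sym_coef S1 z q + sym_coef S2 z q"
  "sym_coef (t # S) z q = (if fst (snd t) = z \<and> snd (snd t) = q then fst t else 0) + sym_coef S z q"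
  by (auto simp: sym_coef_def split: prod.splits)

lemma sym_coef_concat: "sym_coef (concat Ss) z q = (\<Sum>S\<leftarrow>Ss. sym_coef S z q)"
  by (induction Ss) auto

lemma sym_coef_lmul: "sym_coef (sym_lmul A S) z q = sp_mult A (sym_coef S z q)"
  by (induction S) (auto simp: sym_lmul_def sp_mult_add)

lemma sym_coef_scale: "sym_coef (sym_scale c S) z q = sp_smult c (sym_coef S z q)"
  by (induction S) (auto simp: sym_scale_def sp_smult_add)

lemma sym_coef_rcomp: "sym_coef (sym_rcomp_dbar S w r) z q = sym_coef S (z - w) (q \<noteq> r)"
  by (induction S) (auto simp: sym_rcomp_dbar_def algebra_simps)

text \<open>The coefficient of order z - m in Dbar^z_q o G. The index is an integer because orders
  above z are looked up as well, when the action is shown to raise no order.\<close>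

definition dcoef :: "complex \<Rightarrow> bool \<Rightarrow> spoly \<Rightarrow> int \<Rightarrow> spoly" where
  "dcoef z q G m = (if m < 0 then 0 else let i = nat m div 2 in
     if \<not> q then (if even m then sp_smult ((-1)^i * ((z/2) gchoose i)) ((sp_dx ^^ i) G) else 0)
     else sp_smult ((-1)^i * (((z-1)/2) gchoose i)) ((sp_dx ^^ i) (if even m then sp_sigma G else sp_Dbar G)))"

lemma sp_deg_sigma [simp]: "sp_deg (sp_sigma G) = sp_deg G"
  by (simp add: sp_deg_def sp_sigma_def)

lemma sp_deg_Dbar: "sp_deg (sp_Dbar G) \<le> sp_deg G"
  by (auto simp: sp_deg_def sp_Dbar_pair degree_pderiv)

text \<open>Distinct i give distinct orders, so at most one list entry meets a given order; the
  assumption makes the truncation at N harmless.\<close>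

lemma sym_coef_map_upt:
  assumes "\<And>i. N \<le> i \<Longrightarrow> f i = 0"
  shows "sym_coef (map (\<lambda>i. (f i, z - 2 * of_nat i, q)) [0..<N]) (z - of_int m) q' =
    (if q' = q \<and> m \<ge> 0 \<and> even m then f (nat m div 2) else 0)"
proof -
  have eq: "z - 2 * of_nat i = z - of_int m \<longleftrightarrow> m = 2 * int i" for i :: nat
  proof -
    have "z - 2 * of_nat i = z - of_int m \<longleftrightarrow> (of_int (2 * int i) :: complex) = of_int m" by simp
    then show ?thesis by (simp only: of_int_eq_iff eq_commute)
  qed
  have "sym_coef (map (\<lambda>i. (f i, z - 2 * of_nat i, q)) [0..<N]) (z - of_int m) q'
      = (\<Sum>i\<in>{0..<N}. if m = 2 * int i \<and> q = q' then f i else 0)"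
    by (simp add: sym_coef_def o_def eq sum_list_distinct_conv_sum_set cong: if_cong)
  also have "\<dots> = (if q' = q \<and> m \<ge> 0 \<and> even m then f (nat m div 2) else 0)"
  proof (cases "q' = q \<and> m \<ge> 0 \<and> even m")
    case True
    then obtain i where i: "m = 2 * int i" by (metis evenE nonneg_int_cases zero_le_mult_iff zero_less_numeral not_numeral_less_zero order_less_le zero_le_numeral linorder_not_less)
    have "(\<Sum>i'\<in>{0..<N}. if m = 2 * int i' \<and> q = q' then f i' else 0)
        = (\<Sum>i'\<in>{0..<N}. if i = i' then f i' else 0)"
      using True i by (intro sum.cong) auto
    also have "\<dots> = (if i < N then f i else 0)" by (simp add: sum.delta)
    also have "\<dots> = f i" using assms by auto
    finally show ?thesis using True i by (simp add: nat_mult_distrib)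
  next
    case False
    then show ?thesis by (auto intro!: sum.neutral)
  qed
  finally show ?thesis .
qed

lemma sym_coef_dbar_comp_poly:
  "sym_coef (dbar_comp_poly z q G) (z - of_int m) (q \<noteq> odd m) = dcoef z q G m"
proof (cases q)
  case False
  show ?thesis using False unfolding dbar_comp_poly_def dcoef_def
    by (subst if_P, simp, subst sym_coef_map_upt) (auto simp: sp_dx_funpow_eq_0 Let_def)
next
  case True
  have z1: "z - of_int m = (z - 1) - of_int (m - 1)" by simp
  have zz: "sp_deg G < i \<Longrightarrow> (sp_dx ^^ i) (sp_Dbar G) = 0" for i
    using sp_deg_Dbar[of G] by (intro sp_dx_funpow_eq_0) simp
  have A: "sym_coef (map (\<lambda>i. (sp_smult ((-1)^i * (((z-1)/2) gchoose i)) ((sp_dx ^^ i) (sp_sigma G)),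
                 z - 2 * of_nat i, True)) [0..<Suc (sp_deg G)]) (z - of_int m) (q \<noteq> odd m)
     = (if (q \<noteq> odd m) = True \<and> m \<ge> 0 \<and> even m then sp_smult ((-1)^(nat m div 2) * (((z-1)/2) gchoose (nat m div 2))) ((sp_dx ^^ (nat m div 2)) (sp_sigma G)) else 0)"
    by (subst sym_coef_map_upt) (auto simp: sp_dx_funpow_eq_0)
  have B: "sym_coef (map (\<lambda>i. (sp_smult ((-1)^i * (((z-1)/2) gchoose i)) ((sp_dx ^^ i) (sp_Dbar G)),
                 z - 1 - 2 * of_nat i, False)) [0..<Suc (sp_deg G)]) (z - of_int m) (q \<noteq> odd m)
     = (if (q \<noteq> odd m) = False \<and> m - 1 \<ge> 0 \<and> even (m - 1) then sp_smult ((-1)^(nat (m-1) div 2) * (((z-1)/2) gchoose (nat (m-1) div 2))) ((sp_dx ^^ (nat (m-1) div 2)) (sp_Dbar G)) else 0)"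
    unfolding z1 by (subst sym_coef_map_upt) (auto simp: zz)
  \<comment> \<open>The list of odd-order terms starts at z - 1, so its index comes from m -
    1.\<close>
  have C: "nat (m - 1) div 2 = nat m div 2" if odm: "odd m" "m > 0"
  proof -
    obtain k where k: "m = 2 * k + 1" using odm(1) by (rule oddE)
    then show ?thesis using odm(2) by (simp add: nat_add_distrib nat_mult_distrib)
  qed
  have D: "m \<ge> 1" if "odd m" "\<not> m < 0" using that by presburger
  have "sym_coef (dbar_comp_poly z q G) (z - of_int m) (q \<noteq> odd m) =
     (if (q \<noteq> odd m) = False \<and> m - 1 \<ge> 0 \<and> even (m - 1) then sp_smult ((-1)^(nat (m-1) div 2) * (((z-1)/2) gchoose (nat (m-1) div 2))) ((sp_dx ^^ (nat (m-1) div 2)) (sp_Dbar G)) else 0)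
     + (if (q \<noteq> odd m) = True \<and> m \<ge> 0 \<and> even m then sp_smult ((-1)^(nat m div 2) * (((z-1)/2) gchoose (nat m div 2))) ((sp_dx ^^ (nat m div 2)) (sp_sigma G)) else 0)"
    unfolding A[symmetric] B[symmetric] using True
    by (simp add: dbar_comp_poly_def del: upt_Suc)
  then show ?thesis
    using True C D by (auto simp: dcoef_def Let_def)
qed

lemma sym_coef_comp:
  "sym_coef (sym_comp S1 S2) z q = (\<Sum>(A,za,qa)\<leftarrow>S1. \<Sum>(B,zb,qb)\<leftarrow>S2.
     sp_mult A (sym_coef (dbar_comp_poly za qa B) (z - zb) (q \<noteq> qb)))"
  by (simp add: sym_comp_def sym_coef_concat o_def split_def sym_coef_lmul sym_coef_rcomp)

lemma sym_coef_comp_Cons: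
  "sym_coef (sym_comp S1 (t # S)) z q = sym_coef (sym_comp S1 [t]) z q + sym_coef (sym_comp S1 S) z q"
  by (simp add: sym_coef_comp split_def sum_list_addf)

lemma sym_coef_act_hom_Cons:
  "sym_coef (act_hom lam mu fp F (t # S)) z q
    = sym_coef (act_hom lam mu fp F [t]) z q + sym_coef (act_hom lam mu fp F S) z q"
  unfolding act_hom_def by (simp add: sym_coef_comp_Cons[of _ t S] algebra_simps)

lemma sym_coef_act_hom_Nil: "sym_coef (act_hom lam mu fp F []) z q = 0"
  unfolding act_hom_def by (simp add: sym_coef_comp split_def)

text \<open>Composition is additive and the parity split works term by term, so the action can be
  computed on one term T o Dbar^z_q at a time.\<close>

lemma sym_coef_act:
  "sym_coef (sym_act lam mu F S) z q = (\<Sum>t\<leftarrow>S. sym_coef (sym_act lam mu F [t]) z q)"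
proof (induction S)
  case Nil
  then show ?case by (simp add: sym_act_def sym_coef_act_hom_Nil)
next
  case (Cons t S)
  then show ?case unfolding sym_act_def
    by (simp add: sym_coef_act_hom_Cons[of _ _ _ _ t S] algebra_simps)
qed

lemma sym_coef_LX_comp:
  "sym_coef (sym_comp (LX mu F) [(G,z,q)]) (z - of_int m) (q \<noteq> odd m) =
     sp_mult (- F) (dcoef 2 False G (m + 2)) + sp_mult (sp_smult (1/2) (sp_D F)) (dcoef 1 True G (m + 1))
     + sp_mult (sp_smult mu (sp_dx F)) (dcoef 0 False G m)"
proof -
  have *: "z - of_int m - z = 2 - of_int (m + 2)" "((q \<noteq> odd m) \<noteq> q) = (False \<noteq> odd (m + 2))"
     "z - of_int m - z = 1 - of_int (m + 1)" "((q \<noteq> odd m) \<noteq> q) = (True \<noteq> odd (m + 1))"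
     "z - of_int m - z = 0 - of_int m" "((q \<noteq> odd m) \<noteq> q) = (False \<noteq> odd m)"
    by auto
  show ?thesis
    unfolding sym_coef_dbar_comp_poly[symmetric]
    by (simp only: sym_coef_comp LX_def list.map sum_list.Cons sum_list.Nil split_conv *(1,2)[symmetric] *(3,4)[symmetric] *(5,6)[symmetric] add_0_right add.assoc)
qed

lemma sym_coef_comp_LX:
  "sym_coef (sym_comp [(A,z,q)] (LX lam F)) (z - of_int m) (q \<noteq> odd m) =
     sp_mult A (dcoef z q (- F) (m + 2) + dcoef z q (sp_smult (1/2) (sp_D F)) (m + 1)
     + dcoef z q (sp_smult lam (sp_dx F)) m)"
proof -
  have *: "z - of_int m - 2 = z - of_int (m + 2)" "((q \<noteq> odd m) \<noteq> False) = (q \<noteq> odd (m + 2))"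
     "z - of_int m - 1 = z - of_int (m + 1)" "((q \<noteq> odd m) \<noteq> True) = (q \<noteq> odd (m + 1))"
     "z - of_int m - 0 = z - of_int m" "((q \<noteq> odd m) \<noteq> False) = (q \<noteq> odd m)"
    by auto
  show ?thesis
    unfolding sym_coef_dbar_comp_poly[symmetric]
    by (simp only: sym_coef_comp LX_def list.map sum_list.Cons sum_list.Nil split_conv * add_0_right add.assoc sp_mult_add) simp
qed

lemma dcoef_neg: "m < 0 \<Longrightarrow> dcoef z q G m = 0"
  by (simp add: dcoef_def)

lemma dcoef_of_nat: "dcoef z q G (int s) = (let i = s div 2 in
     if \<not> q then (if even s then sp_smult ((-1)^i * ((z/2) gchoose i)) ((sp_dx ^^ i) G) else 0)
     else sp_smult ((-1)^i * (((z-1)/2) gchoose i)) ((sp_dx ^^ i) (if even s then sp_sigma G else sp_Dbar G)))"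
  by (simp add: dcoef_def Let_def nat_div_distrib)

lemma dcoef_numeral:
  "dcoef z q G 0 = (if q then sp_sigma G else G)"
  "dcoef z q G 1 = (if q then sp_Dbar G else 0)"
  "dcoef z q G 2 = (if q then sp_smult (- ((z - 1) / 2)) (sp_dx (sp_sigma G)) else sp_smult (- (z / 2)) (sp_dx G))"
proof -
  have 1: "sp_smult 1 H = H" for H by (simp add: sp_smult_def)
  have 2: "- (((z - 1) / 2)) = (-1) ^ 1 * ((z - 1) / 2 gchoose 1)" "- (z / 2) = (-1) ^ 1 * (z / 2 gchoose 1)"
    by (simp_all add: field_simps)
  show "dcoef z q G 2 = (if q then sp_smult (- ((z - 1) / 2)) (sp_dx (sp_sigma G)) else sp_smult (- (z / 2)) (sp_dx G))"
    unfolding 2 by (simp only: dcoef_def Let_def) simp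
  show "dcoef z q G 0 = (if q then sp_sigma G else G)" "dcoef z q G 1 = (if q then sp_Dbar G else 0)"
    by (simp_all add: dcoef_def 1)
qed

section \<open>Entries of the action from one slot to another\<close>

lemma zero_gchoose: "(0::complex) gchoose i = (if i = 0 then 1 else 0)"
  by (cases i) auto
lemma one_gchoose: "(1::complex) gchoose i = (if i \<le> 1 then 1 else 0)"
proof -
  have "(of_nat 1 :: complex) gchoose i = of_nat (1 choose i)" by (rule binomial_gbinomial[symmetric])
  moreover have "1 choose i = (if i \<le> 1 then 1 else 0)" by (cases i) (auto simp: binomial_eq_0)
  ultimately show ?thesis by (auto split: if_splits)
qed

text \<open>L_mu(X_F) is a first-order operator: the binomials of 1 and 0 that would produce orders
  below z vanish. Everything below the diagonal comes from T o L_lam(X_F), which is why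
  \<open>lower_coef\<close> depends on lam but not on mu.\<close>

lemma sym_coef_LX_comp_0:
  assumes "s > 0"
  shows "sym_coef (sym_comp (LX mu F) [(G,z,q)]) (z - of_int (int s)) (q \<noteq> odd (int s)) = 0"
proof -
  have "dcoef 2 False G (int s + 2) = 0"
    using dcoef_of_nat[of 2 False G "s + 2"] assms by (auto simp: one_gchoose Let_def add.commute elim!: oddE)
  moreover have "dcoef 1 True G (int s + 1) = 0"
    using dcoef_of_nat[of 1 True G "s + 1"] assms by (auto simp: zero_gchoose Let_def add.commute)
  moreover have "dcoef 0 False G (int s) = 0"
    using dcoef_of_nat[of 0 False G "s"] assms by (auto simp: zero_gchoose Let_def)
  ultimately show ?thesis unfolding sym_coef_LX_comp by simp
qed

lemma pderiv_funpow_smult: "(pderiv ^^ i) (smult c p) = smult c ((pderiv ^^ i) p)" for p :: "complex poly"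
  by (induction i) (auto simp: pderiv_smult)
lemma pderiv_funpow_minus: "(pderiv ^^ i) (- p) = - ((pderiv ^^ i) p)" for p :: "complex poly"
  by (induction i) (auto simp: pderiv_minus)
lemma pderiv_funpow_swap: "(pderiv ^^ i) (pderiv p) = pderiv ((pderiv ^^ i) p)" for p :: "complex poly"
  by (induction i) auto

lemma smult_half_two: "smult (c / 2) (q * (2 * p)) = smult c (q * p)"
  "smult (c / 2) (q * (p * 2)) = smult c (q * p)" for p q :: "complex poly"
proof -
  have "q * (2 * p) = smult 2 (q * p)"
    by (simp add: numeral_poly)
  then show "smult (c / 2) (q * (2 * p)) = smult c (q * p)" "smult (c / 2) (q * (p * 2)) = smult c (q * p)"
    by (simp_all add: mult.commute[of p])
qed

lemmas sp_comp_simps = smult_half_two sp_mult_def sp_smult_def sp_D_pair sp_Dbar_pair sp_sigma_def sp_dx_def sp_dx_funpow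
  pderiv_funpow_0 pderiv_funpow_smult pderiv_funpow_minus pderiv_funpow_swap zero_prod_def pderiv_smult pderiv_minus

lemma sp_sigma_funpow: "(sp_sigma ^^ i) G = (if even i then G else sp_sigma G)"
  by (induction i) (auto simp: sp_sigma_def)

text \<open>At even distance 2i the three summands of \<open>LX lam F\<close> all contribute
  multiples of the x-derivative of F of order i + 1, so they add up to a single jet. The super sign
  cancels the sigma that an odd Dbar puts on F.\<close>

lemma sym_coef_act_lower_even:
  assumes "i > 0"
  shows "sym_coef (sym_act lam mu F [(G,z,q)]) (z - of_int (int (2 * i))) (q \<noteq> odd (int (2 * i)))
    = sp_smult (lower_coef lam z q (2 * i)) (jet_prod (2 * i + 2) 0 F G)"
proof -
  have e: "int (2 * i) + 2 = int (2 * i + 2)" "int (2 * i) + 1 = int (2 * i + 1)" by auto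
  have dd: "(2 * i + 2) div 2 = Suc i" "(2 * i + 1) div 2 = i" by auto
  have N: "jet_prod (2 * i + 2) 0 F G = sp_mult ((sp_dx ^^ Suc i) F) G"
    using sp_D_funpow_even[of "Suc i" F] by (simp add: jet_prod_def sp_sigma_funpow)
  show ?thesis
    unfolding sym_act_def act_hom_def N
    apply (simp only: list.map concat.simps append_Nil2 sym_coef_simps split_conv sym_coef_scale
       sym_coef_comp_LX sym_coef_LX_comp_0[of "2*i"] assms mult_pos_pos zero_less_numeral e dcoef_of_nat dd Let_def lower_coef_def fst_conv snd_conv)
    apply (cases q)
    apply (simp_all add: sp_comp_simps prod_eq_iff algebra_simps smult_add_left smult_diff_left smult_add_right smult_diff_right)
    done
qed

text \<open>The common jet is now an x-derivative of D(F), of parity opposite to F, and the super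
  sign survives as the sigma on G.\<close>

lemma sym_coef_act_lower_odd:
  "sym_coef (sym_act lam mu F [(G,z,q)]) (z - of_int (int (2 * i + 1))) (q \<noteq> odd (int (2 * i + 1)))
    = sp_smult (lower_coef lam z q (2 * i + 1)) (jet_prod (2 * i + 3) 0 F G)"
proof -
  have e: "int (2 * i + 1) + 2 = int (2 * i + 3)" "int (2 * i + 1) + 1 = int (2 * i + 2)" by auto
  have dd: "(2 * i + 3) div 2 = Suc i" "(2 * i + 2) div 2 = Suc i" "(2 * i + 1) div 2 = i" by auto
  have N: "jet_prod (2 * i + 3) 0 F G = sp_mult ((sp_dx ^^ Suc i) (sp_D F)) (sp_sigma G)"
    using sp_D_funpow_odd[of "Suc i" F] by (simp add: jet_prod_def sp_sigma_funpow numeral_3_eq_3)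
  show ?thesis
    unfolding sym_act_def act_hom_def N
    apply (simp only: list.map concat.simps append_Nil2 sym_coef_simps split_conv sym_coef_scale
       sym_coef_comp_LX sym_coef_LX_comp_0[of "2*i+1"] add_pos_pos zero_less_one add_nonneg_pos zero_le e dcoef_of_nat dd Let_def lower_coef_def fst_conv snd_conv)
    apply (cases q)
    apply (simp_all add: sp_comp_simps prod_eq_iff algebra_simps smult_add_left smult_diff_left smult_add_right smult_diff_right)
    done
qed

lemma sym_coef_act_lower:
  assumes "s > 0"
  shows "sym_coef (sym_act lam mu F [(G,z,q)]) (z - of_nat s) (q \<noteq> odd s)
    = sp_smult (lower_coef lam z q s) (jet_prod (s + 2) 0 F G)"
proof (cases "even s")
  case True
  then obtain i where "s = 2 * i" by (elim evenE)
  then show ?thesis using sym_coef_act_lower_even[of i lam mu F G z q] assms by simp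
next
  case False
  then obtain i where "s = 2 * i + 1" by (elim oddE)
  then show ?thesis using sym_coef_act_lower_odd[of lam mu F G z q i] by (simp add: numeral_3_eq_3)
qed

lemma sym_coef_act_diag:
  "sym_coef (sym_act lam mu F [(G,z,q)]) z q = dens (mu - lam - z / 2) F G"
proof -
  have "sym_coef (sym_act lam mu F [(G,z,q)]) (z - of_int 0) (q \<noteq> odd (0::int)) = dens (mu - lam - z / 2) F G"
    unfolding sym_act_def act_hom_def dens_def jet_prod_def
    apply (simp only: list.map concat.simps append_Nil2 sym_coef_simps split_conv sym_coef_scale
       sym_coef_comp_LX sym_coef_LX_comp)
    apply (cases q)
    apply (simp_all add: sp_comp_simps prod_eq_iff algebra_simps smult_add_left smult_diff_left smult_add_right smult_diff_right
       dcoef_numeral numeral_2_eq_2 diff_divide_distrib pderiv_add pderiv_diff)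
    done
  then show ?thesis by simp
qed

text \<open>The contributions of orders z + 2 and z + 1 to L_mu(X_F) o T and T o L_lam(X_F) cancel
  in the supercommutator, and no higher order arises.\<close>

lemma sym_coef_act_upper:
  assumes "s > 0"
  shows "sym_coef (sym_act lam mu F [(G,z,q)]) (z + of_nat s) (q \<noteq> odd s) = 0"
proof -
  have *: "sym_coef (sym_act lam mu F [(G,z,q)]) (z - of_int m) (q \<noteq> odd m) = 0" if m: "m < 0" for m
  proof -
    have "m = - 1 \<or> m = - 2 \<or> m < -2" using m by linarith
    moreover have ?thesis if "m < - 2"
    proof -
      have [simp]: "m + 2 < 0" "m + 1 < 0" using that by auto
      show ?thesis unfolding sym_act_def act_hom_def
        using m by (simp only: list.map concat.simps append_Nil2 sym_coef_simps split_conv sym_coef_scale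
       sym_coef_comp_LX sym_coef_LX_comp dcoef_neg) (simp add: dcoef_neg)
    qed
    moreover have ?thesis if m: "m = - 1"
    proof -
      show ?thesis unfolding m sym_act_def act_hom_def
        apply (simp only: list.map concat.simps append_Nil2 sym_coef_simps split_conv sym_coef_scale
         sym_coef_comp_LX sym_coef_LX_comp)
        apply (cases q)
         apply (simp_all add: sp_comp_simps prod_eq_iff algebra_simps dcoef_numeral dcoef_neg)
        done
    qed
    moreover have ?thesis if m: "m = - 2"
    proof -
      show ?thesis unfolding m sym_act_def act_hom_def
        apply (simp only: list.map concat.simps append_Nil2 sym_coef_simps split_conv sym_coef_scale
         sym_coef_comp_LX sym_coef_LX_comp)
        apply (cases q)
         apply (simp_all add: sp_comp_simps prod_eq_iff algebra_simps dcoef_numeral dcoef_neg)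
        done
    qed
    ultimately show ?thesis by blast
  qed
  show ?thesis using *[of "- int s"] assms by simp
qed

text \<open>The action is triangular in the slots. With k = delta - n the diagonal weight is n +
  j/2.\<close>

lemma sq_act_formula:
  assumes "j < l"
  shows "sq_act lam mu k p l F T j = dens (mu - lam - k + of_nat j / 2) F (T j)
    + (\<Sum>i<j. sp_smult (lower_coef lam (2 * k - of_nat i) (p \<noteq> odd i) (j - i)) (jet_prod (j - i + 2) 0 F (T i)))"
proof -
  let ?c = "\<lambda>i. sym_coef (sym_act lam mu F [(T i, 2 * k - of_nat i, p \<noteq> odd i)]) (2 * k - of_nat j) (p \<noteq> odd j)"
  have less: "?c i = sp_smult (lower_coef lam (2 * k - of_nat i) (p \<noteq> odd i) (j - i)) (jet_prod (j - i + 2) 0 F (T i))"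
    if "i < j" for i
  proof -
    have "((p \<noteq> odd i) \<noteq> odd (j - i)) = (p \<noteq> odd j)" using that by auto
    then show ?thesis
      using sym_coef_act_lower[of "j - i" lam mu F "T i" "2 * k - of_nat i" "p \<noteq> odd i"] that
      by (simp only: of_nat_diff less_imp_le zero_less_diff) simp
  qed
  have eq: "?c j = dens (mu - lam - k + of_nat j / 2) F (T j)"
    by (simp add: sym_coef_act_diag diff_divide_distrib algebra_simps)
  have gt: "?c i = 0" if "i > j" for i
  proof -
    have "((p \<noteq> odd i) \<noteq> odd (i - j)) = (p \<noteq> odd j)" using that by auto
    then show ?thesis
      using sym_coef_act_upper[of "i - j" lam mu F "T i" "2 * k - of_nat i" "p \<noteq> odd i"] that
      by (simp only: of_nat_diff less_imp_le zero_less_diff) simp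
  qed
  have "sq_act lam mu k p l F T j = (\<Sum>i\<leftarrow>[0..<l]. ?c i)"
    using assms by (simp add: sq_act_def sq_sym_def sym_coef_act[of _ _ _ "map _ _"] o_def)
  also have "\<dots> = (\<Sum>i<l. ?c i)"
    by (simp add: sum_list_distinct_conv_sum_set atLeast0LessThan)
  also have "\<dots> = (\<Sum>i<Suc j. ?c i)"
    using assms by (intro sum.mono_neutral_right) (auto simp: gt[simplified] Suc_le_eq)
  also have "\<dots> = ?c j + (\<Sum>i<j. ?c i)" by (simp add: add.commute)
  also have "(\<Sum>i<j. ?c i) = (\<Sum>i<j. sp_smult (lower_coef lam (2 * k - of_nat i) (p \<noteq> odd i) (j - i)) (jet_prod (j - i + 2) 0 F (T i)))"
    by (intro sum.cong refl less) auto
  finally show ?thesis unfolding eq .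
qed

section \<open>Coefficient identities for the projective quantization\<close>

text \<open>Comparing the coefficients of D^3(F) D^(s-1)(G) on both sides of the intertwining relation for the
quantization G \<mapsto> qcoef 0 * G + qcoef 1 * D(G) + ... of a density of weight nu gives this recursion.\<close>
fun qcoef :: "complex \<Rightarrow> complex \<Rightarrow> bool \<Rightarrow> complex \<Rightarrow> nat \<Rightarrow> complex" where
  "qcoef lam d q nu 0 = 1"
| "qcoef lam d q nu (Suc s) = qcoef lam d q nu s * lower_coef lam (2 * (d - nu) - of_nat s) (q \<noteq> odd s) 1
     / (if odd s then of_nat (Suc s) / 4 else nu + of_nat s / 4)"

text \<open>Here h = lam + mu - 1/2, so that gamma^(1/2) = sqrt 3 * h.\<close>
definition cocycle_at :: "complex \<Rightarrow> complex \<Rightarrow> bool \<Rightarrow> complex \<Rightarrow> nat \<Rightarrow> complex" where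
  "cocycle_at lam d q nu s = (let x = d - nu; h = 2 * lam + d - 1/2 in
    if s = 3 then - 1 / (4 * nu + 2) *
       (if \<not> q then x * (x - 1) * h else (x - 1/2) * (3 * h^2 - 3 * (nu + 1/2) * d - 3/4) / 3)
    else if s = 4 then - 1 / (48 * nu * (nu + 3/2)) *
       (if \<not> q then x * (x - 1) * (3 * h^2 - (nu + 3/2) * (2 * d + nu + 1/2))
        else (x - 1/2) * (x - 3/2) * (3 * h^2 - nu * (2 * d + nu + 1)))
    else if s = 5 then 1 / (48 * nu * (nu + 1) * (nu + 2)) *
       (if \<not> q then x * (x - 1) * (x - 2) * (3 * h^2 - (nu + 1) * d - 3/4)
        else (x - 1/2) * (x - 3/2) * (3 * h^3 - h * (4 * (nu + 1) * d - (nu + 1)^2 + 3)))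
    else 0)"

text \<open>The Leibniz rule on the coefficients of the sum over a <= m of e a *
  \<open>jet_prod a (m - a) F G\<close>: D either hits F and raises a, or passes to G with the sign
  (-1)^a from D sigma^a = (-1)^a sigma^a D. The test a <= m keeps values of e beyond the order m out
  of the new top coefficient.\<close>

definition D_coef :: "nat \<Rightarrow> (nat \<Rightarrow> complex) \<Rightarrow> nat \<Rightarrow> complex" where
  "D_coef m e a = (if a = 0 then 0 else e (a - 1)) + (if a \<le> m then (-1)^a * e a else 0)"

fun D_coef_pow :: "nat \<Rightarrow> nat \<Rightarrow> (nat \<Rightarrow> complex) \<Rightarrow> nat \<Rightarrow> complex" where
  "D_coef_pow 0 m e = e"
| "D_coef_pow (Suc t) m e = D_coef (m + t) (D_coef_pow t m e)"

definition dens_coef :: "complex \<Rightarrow> nat \<Rightarrow> complex" where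
  "dens_coef nu a = (if a = 0 then 1 else if a = 1 then 1/2 else if a = 2 then nu else 0)"

text \<open>With f = D^5(F), of weight 3/2, these are up to sign conventions f G, then the
  supertransvectant of order 1/2 (2 nu and 3 are the doubled weights), then twice the contact
  bracket of f and G.\<close>

definition transvec_coef :: "complex \<Rightarrow> nat \<Rightarrow> nat \<Rightarrow> complex" where
  "transvec_coef nu s a = (if s = 3 then (if a = 5 then 1 else 0)
     else if s = 4 then (if a = 6 then 2 * nu else if a = 5 then 3 else 0)
     else if s = 5 then (if a = 7 then 2 * nu else if a = 6 then -1 else if a = 5 then -3 else 0)
     else 0)"

text \<open>lhs_coef and rhs_coef list the coefficients of D^a(F) sigma^a(D^(s+2-a)(G)) in slot s of
X_F(Q(G)) and of Q applied to the normal form of the action on G, for the quantization Q.\<close>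
definition lhs_coef :: "complex \<Rightarrow> complex \<Rightarrow> bool \<Rightarrow> complex \<Rightarrow> nat \<Rightarrow> nat \<Rightarrow> complex" where
  "lhs_coef lam d q nu s a = qcoef lam d q nu s * dens_coef (nu + of_nat s / 2) a +
    (if 3 \<le> a then lower_coef lam (2 * (d - nu) - of_nat (s + 2 - a)) (q \<noteq> odd (s + 2 - a)) (a - 2)
          * qcoef lam d q nu (s + 2 - a) else 0)"

definition rhs_coef :: "complex \<Rightarrow> complex \<Rightarrow> bool \<Rightarrow> complex \<Rightarrow> nat \<Rightarrow> nat \<Rightarrow> complex" where
  "rhs_coef lam d q nu s a = qcoef lam d q nu s * D_coef_pow s 2 (dens_coef nu) a +
     (\<Sum>k\<leftarrow>[3,4,5]. if k \<le> s then qcoef lam d (q \<noteq> odd k) (nu + of_nat k / 2) (s - k)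
        * cocycle_at lam d q nu k * D_coef_pow (s - k) (k + 2) (transvec_coef nu k) a else 0)"

lemma gchoose_small:
  "x gchoose 0 = 1" "x gchoose 1 = x" "x gchoose 2 = x * (x - 1) / 2" "x gchoose 3 = x * (x - 1) * (x - 2) / 6"
  for x :: complex
  by (simp_all add: gbinomial_prod_rev eval_nat_numeral lessThan_Suc atLeast0_lessThan_Suc)

lemma lower_coef_numeral:
  "lower_coef lam z q 1 = (if q then (z - 1) / 4 + lam else z / 4)"
  "lower_coef lam z q 2 = (if q then ((z - 1)/2) * ((z - 1)/2 - 1) / 2 + (1/2 + lam) * ((z - 1)/2)
     else (z/2) * (z/2 - 1) / 2 + lam * (z/2))"
  "lower_coef lam z q 3 = - (if q then ((z - 1)/2) * ((z - 1)/2 - 1) / 4 + lam * ((z - 1)/2)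
     else (z/2) * (z/2 - 1) / 4)"
  "lower_coef lam z q 4 = - (if q then ((z - 1)/2) * ((z - 1)/2 - 1) * ((z - 1)/2 - 2) / 6 + (1/2 + lam) * ((z - 1)/2) * ((z - 1)/2 - 1) / 2
     else (z/2) * (z/2 - 1) * (z/2 - 2) / 6 + lam * (z/2) * (z/2 - 1) / 2)"
  "lower_coef lam z q 5 = (if q then ((z - 1)/2) * ((z - 1)/2 - 1) * ((z - 1)/2 - 2) / 12 + lam * ((z - 1)/2) * ((z - 1)/2 - 1) / 2
     else (z/2) * (z/2 - 1) * (z/2 - 2) / 12)"
proof -
  have S: "Suc 0 = 1" "Suc 1 = 2" "Suc 2 = 3" by simp_all
  have dv: "(1::nat) div 2 = 0" "(2::nat) div 2 = 1" "(3::nat) div 2 = 1" "(4::nat) div 2 = 2" "(5::nat) div 2 = 2"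
    by simp_all
  show "lower_coef lam z q 1 = (if q then (z - 1) / 4 + lam else z / 4)"
    unfolding lower_coef_def dv S gchoose_small by (simp add: diff_divide_distrib add_divide_distrib)
  show "lower_coef lam z q 2 = (if q then ((z - 1)/2) * ((z - 1)/2 - 1) / 2 + (1/2 + lam) * ((z - 1)/2)
     else (z/2) * (z/2 - 1) / 2 + lam * (z/2))"
    unfolding lower_coef_def dv S gchoose_small by (simp add: diff_divide_distrib add_divide_distrib)
  show "lower_coef lam z q 3 = - (if q then ((z - 1)/2) * ((z - 1)/2 - 1) / 4 + lam * ((z - 1)/2)
     else (z/2) * (z/2 - 1) / 4)"
    unfolding lower_coef_def dv S gchoose_small by (simp add: diff_divide_distrib add_divide_distrib)
  show "lower_coef lam z q 4 = - (if q then ((z - 1)/2) * ((z - 1)/2 - 1) * ((z - 1)/2 - 2) / 6 + (1/2 + lam) * ((z - 1)/2) * ((z - 1)/2 - 1) / 2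
     else (z/2) * (z/2 - 1) * (z/2 - 2) / 6 + lam * (z/2) * (z/2 - 1) / 2)"
    unfolding lower_coef_def dv S gchoose_small by (simp add: mult.assoc)
  show "lower_coef lam z q 5 = (if q then ((z - 1)/2) * ((z - 1)/2 - 1) * ((z - 1)/2 - 2) / 12 + lam * ((z - 1)/2) * ((z - 1)/2 - 1) / 2
     else (z/2) * (z/2 - 1) * (z/2 - 2) / 12)"
    unfolding lower_coef_def dv S gchoose_small by (simp add: mult.assoc)
qed

lemma qcoef_numeral:
  "qcoef lam d q nu (numeral k) = qcoef lam d q nu (pred_numeral k)
     * lower_coef lam (2 * (d - nu) - of_nat (pred_numeral k)) (q \<noteq> odd (pred_numeral k)) 1
     / (if odd (pred_numeral k) then of_nat (numeral k) / 4 else nu + of_nat (pred_numeral k) / 4)"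
  by (simp only: numeral_eq_Suc qcoef.simps)
lemma qcoef_1: "qcoef lam d q nu 1 = lower_coef lam (2 * (d - nu)) q 1 / nu"
  by simp

lemma D_coef_pow_numeral:
  "D_coef_pow (numeral k) m e = D_coef (m + pred_numeral k) (D_coef_pow (pred_numeral k) m e)"
  by (simp add: numeral_eq_Suc)
lemma D_coef_pow_1: "D_coef_pow 1 m e = D_coef m e" "D_coef_pow (Suc 0) m e = D_coef m e"
  by simp_all

lemmas coef_eval = lhs_coef_def rhs_coef_def qcoef_numeral qcoef_1 D_coef_pow_numeral D_coef_pow_1 D_coef_def dens_coef_def transvec_coef_def cocycle_at_def Let_def
  lower_coef_numeral lower_coef_numeral(1)[unfolded One_nat_def]

lemma linear_numeral_eq_0:
  fixes nu :: complex
  shows "numeral m + nu * numeral n = 0 \<longleftrightarrow> nu = - (numeral m / numeral n)"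
    "nu * numeral n + numeral m = 0 \<longleftrightarrow> nu = - (numeral m / numeral n)"
    "numeral n * nu + numeral m = 0 \<longleftrightarrow> nu = - (numeral m / numeral n)"
    "1 + nu * numeral n = 0 \<longleftrightarrow> nu = - (1 / numeral n)"
    "nu * numeral n + 1 = 0 \<longleftrightarrow> nu = - (1 / numeral n)"
    "numeral n * nu + 1 = 0 \<longleftrightarrow> nu = - (1 / numeral n)"
    "nu + numeral m = 0 \<longleftrightarrow> nu = - numeral m"
    "nu + 1 = 0 \<longleftrightarrow> nu = - 1"
    "1 + nu = 0 \<longleftrightarrow> nu = - 1"
    "nu + 1/2 = 0 \<longleftrightarrow> nu = - (1/2)"
    "1/2 + nu = 0 \<longleftrightarrow> nu = - (1/2)"
    "nu + 3/2 = 0 \<longleftrightarrow> nu = - (3/2)"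
    "3/2 + nu = 0 \<longleftrightarrow> nu = - (3/2)"
  by (auto simp: field_simps eq_neg_iff_add_eq_0)

text \<open>Writing d as nu + x makes every \<open>lower_coef\<close> that occurs a polynomial in x
  and lam. Once the denominators of \<open>qcoef\<close> and \<open>cocycle_at\<close> are cleared,
  each value of a leaves a polynomial identity; the same method serves for s = 2, ..., 5.\<close>

lemma coef_identity_1:
  fixes nu :: complex
  assumes "nu \<noteq> 0" and "a < 4"
  shows "lhs_coef lam (nu + x) q nu 1 a = rhs_coef lam (nu + x) q nu 1 a"
proof -
  note nz = assms(1-1) linear_numeral_eq_0
  let ?P = "\<lambda>q a. lhs_coef lam (nu + x) q nu 1 a = rhs_coef lam (nu + x) q nu 1 a"
  have P0: "?P True 0" "?P False 0"
    by (simp add: coef_eval nz; (simp add: divide_simps nz)?; ((rule disjI2)+)?; algebra)+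
  have P1: "?P True 1" "?P False 1"
    by (simp add: coef_eval nz; (simp add: divide_simps nz)?; ((rule disjI2)+)?; algebra)+
  have P2: "?P True 2" "?P False 2"
    by (simp add: coef_eval nz; (simp add: divide_simps nz)?; ((rule disjI2)+)?; algebra)+
  have P3: "?P True 3" "?P False 3"
    by (simp add: coef_eval nz; (simp add: divide_simps nz)?; ((rule disjI2)+)?; algebra)+
  have "?P True a \<and> ?P False a"
    using assms(2) P0 P1 P2 P3 by (auto simp: less_Suc_eq numeral_eq_Suc)
  then show ?thesis by (cases q) simp_all
qed

lemma coef_identity_2:
  fixes nu :: complex
  assumes "nu \<noteq> 0" "nu \<noteq> - (1/2)" and "a < 5"
  shows "lhs_coef lam (nu + x) q nu 2 a = rhs_coef lam (nu + x) q nu 2 a"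
proof -
  have nz2: "nu * 2 \<noteq> - 1" "2 * nu \<noteq> - 1" using assms(2) by (auto simp: field_simps)
  note nz = assms(1-2) nz2 linear_numeral_eq_0
  let ?P = "\<lambda>q a. lhs_coef lam (nu + x) q nu 2 a = rhs_coef lam (nu + x) q nu 2 a"
  have P0: "?P True 0" "?P False 0"
    by (simp add: coef_eval nz; (simp add: divide_simps nz)?; ((rule disjI2)+)?; algebra)+
  have P1: "?P True 1" "?P False 1"
    by (simp add: coef_eval nz; (simp add: divide_simps nz)?; ((rule disjI2)+)?; algebra)+
  have P2: "?P True 2" "?P False 2"
    by (simp add: coef_eval nz; (simp add: divide_simps nz)?; ((rule disjI2)+)?; algebra)+
  have P3: "?P True 3" "?P False 3"
    by (simp add: coef_eval nz; (simp add: divide_simps nz)?; ((rule disjI2)+)?; algebra)+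
  have P4: "?P True 4" "?P False 4"
    by (simp add: coef_eval nz; (simp add: divide_simps nz)?; ((rule disjI2)+)?; algebra)+
  have "?P True a \<and> ?P False a"
    using assms(3) P0 P1 P2 P3 P4 by (auto simp: less_Suc_eq numeral_eq_Suc)
  then show ?thesis by (cases q) simp_all
qed

lemma coef_identity_3:
  fixes nu :: complex
  assumes "nu \<noteq> 0" "nu \<noteq> - (1/2)" "nu \<noteq> -1" and "a < 6"
  shows "lhs_coef lam (nu + x) q nu 3 a = rhs_coef lam (nu + x) q nu 3 a"
proof -
  have nz2: "nu * 2 \<noteq> - 1" "2 * nu \<noteq> - 1" using assms(2) by (auto simp: field_simps)
  note nz = assms(1-3) nz2 linear_numeral_eq_0
  let ?P = "\<lambda>q a. lhs_coef lam (nu + x) q nu 3 a = rhs_coef lam (nu + x) q nu 3 a"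
  have P0: "?P True 0" "?P False 0"
    by (simp add: coef_eval nz; (simp add: divide_simps nz)?; ((rule disjI2)+)?; algebra)+
  have P1: "?P True 1" "?P False 1"
    by (simp add: coef_eval nz; (simp add: divide_simps nz)?; ((rule disjI2)+)?; algebra)+
  have P2: "?P True 2" "?P False 2"
    by (simp add: coef_eval nz; (simp add: divide_simps nz)?; ((rule disjI2)+)?; algebra)+
  have P3: "?P True 3" "?P False 3"
    by (simp add: coef_eval nz; (simp add: divide_simps nz)?; ((rule disjI2)+)?; algebra)+
  have P4: "?P True 4" "?P False 4"
    by (simp add: coef_eval nz; (simp add: divide_simps nz)?; ((rule disjI2)+)?; algebra)+
  have P5: "?P True 5" "?P False 5"
    by (simp add: coef_eval nz; (simp add: divide_simps nz)?; ((rule disjI2)+)?; algebra)+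
  have "?P True a \<and> ?P False a"
    using assms(4) P0 P1 P2 P3 P4 P5 by (auto simp: less_Suc_eq numeral_eq_Suc)
  then show ?thesis by (cases q) simp_all
qed

lemma coef_identity_4:
  fixes nu :: complex
  assumes "nu \<noteq> 0" "nu \<noteq> - (1/2)" "nu \<noteq> -1" "nu \<noteq> - (3/2)" and "a < 7"
  shows "lhs_coef lam (nu + x) q nu 4 a = rhs_coef lam (nu + x) q nu 4 a"
proof -
  have nz2: "nu * 2 \<noteq> - 1" "2 * nu \<noteq> - 1" using assms(2) by (auto simp: field_simps)
  have nz4: "nu * 2 \<noteq> - 3" "2 * nu \<noteq> - 3" using assms(4) by (auto simp: field_simps)
  note nz = assms(1-4) nz2 nz4 linear_numeral_eq_0
  let ?P = "\<lambda>q a. lhs_coef lam (nu + x) q nu 4 a = rhs_coef lam (nu + x) q nu 4 a"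
  have P0: "?P True 0" "?P False 0"
    by (simp add: coef_eval nz; (simp add: divide_simps nz)?; ((rule disjI2)+)?; algebra)+
  have P1: "?P True 1" "?P False 1"
    by (simp add: coef_eval nz; (simp add: divide_simps nz)?; ((rule disjI2)+)?; algebra)+
  have P2: "?P True 2" "?P False 2"
    by (simp add: coef_eval nz; (simp add: divide_simps nz)?; ((rule disjI2)+)?; algebra)+
  have P3: "?P True 3" "?P False 3"
    by (simp add: coef_eval nz; (simp add: divide_simps nz)?; ((rule disjI2)+)?; algebra)+
  have P4: "?P True 4" "?P False 4"
    by (simp add: coef_eval nz; (simp add: divide_simps nz)?; ((rule disjI2)+)?; algebra)+
  have P5: "?P True 5" "?P False 5"
    by (simp add: coef_eval nz; (simp add: divide_simps nz)?; ((rule disjI2)+)?; algebra)+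
  have P6: "?P True 6" "?P False 6"
    by (simp add: coef_eval nz; (simp add: divide_simps nz)?; ((rule disjI2)+)?; algebra)+
  have "?P True a \<and> ?P False a"
    using assms(5) P0 P1 P2 P3 P4 P5 P6 by (auto simp: less_Suc_eq numeral_eq_Suc)
  then show ?thesis by (cases q) simp_all
qed

text \<open>All five exclusions appear here: quantizing weight nu meets the denominators nu, nu +
  1/2, nu + 1, and quantizing the linked weights nu + 3/2 and nu + 2 meets those two
  themselves.\<close>

lemma coef_identity_5:
  fixes nu :: complex
  assumes "nu \<noteq> 0" "nu \<noteq> - (1/2)" "nu \<noteq> -1" "nu \<noteq> - (3/2)" "nu \<noteq> -2" and "a < 8"
  shows "lhs_coef lam (nu + x) q nu 5 a = rhs_coef lam (nu + x) q nu 5 a"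
proof -
  have nz2: "nu * 2 \<noteq> - 1" "2 * nu \<noteq> - 1" using assms(2) by (auto simp: field_simps)
  have nz4: "nu * 2 \<noteq> - 3" "2 * nu \<noteq> - 3" using assms(4) by (auto simp: field_simps)
  note nz = assms(1-5) nz2 nz4 linear_numeral_eq_0
  let ?P = "\<lambda>q a. lhs_coef lam (nu + x) q nu 5 a = rhs_coef lam (nu + x) q nu 5 a"
  have P0: "?P True 0" "?P False 0"
    by (simp add: coef_eval nz; (simp add: divide_simps nz)?; ((rule disjI2)+)?; algebra)+
  have P1: "?P True 1" "?P False 1"
    by (simp add: coef_eval nz; (simp add: divide_simps nz)?; ((rule disjI2)+)?; algebra)+
  have P2: "?P True 2" "?P False 2"
    by (simp add: coef_eval nz; (simp add: divide_simps nz)?; ((rule disjI2)+)?; algebra)+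
  have P3: "?P True 3" "?P False 3"
    by (simp add: coef_eval nz; (simp add: divide_simps nz)?; ((rule disjI2)+)?; algebra)+
  have P4: "?P True 4" "?P False 4"
    by (simp add: coef_eval nz; (simp add: divide_simps nz)?; ((rule disjI2)+)?; algebra)+
  have P5: "?P True 5" "?P False 5"
    by (simp add: coef_eval nz; (simp add: divide_simps nz)?; ((rule disjI2)+)?; algebra)+
  have P6: "?P True 6" "?P False 6"
    by (simp add: coef_eval nz; (simp add: divide_simps nz)?; ((rule disjI2)+)?; algebra)+
  have P7: "?P True 7" "?P False 7"
    by (simp add: coef_eval nz; (simp add: divide_simps nz)?; ((rule disjI2)+)?; algebra)+
  have "?P True a \<and> ?P False a"
    using assms(6) P0 P1 P2 P3 P4 P5 P6 P7 by (auto simp: less_Suc_eq numeral_eq_Suc)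
  then show ?thesis by (cases q) simp_all
qed

text \<open>The hypothesis says that no two of the densities of weights nu, nu + 1/2, ..., nu + s/2 at odd
distance share the eigenvalue of the square root of the osp(1|2) Casimir up to sign.\<close>
lemma coef_identity:
  assumes "\<And>k. k < s \<Longrightarrow> nu + of_nat k / 2 \<noteq> 0" and "s \<le> 5" "a < s + 3"
  shows "lhs_coef lam d q nu s a = rhs_coef lam d q nu s a"
proof -
  have d: "nu + (d - nu) = d" by simp
  have k0: "nu \<noteq> 0" if "0 < s" using assms(1)[of 0] that by simp
  have k1: "nu \<noteq> - (1/2)" if "1 < s" using assms(1)[of 1] that by auto
  have k2: "nu \<noteq> - 1" if "2 < s" using assms(1)[of 2] that by auto
  have k3: "nu \<noteq> - (3/2)" if "3 < s" using assms(1)[of 3] that by auto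
  have k4: "nu \<noteq> - 2" if "4 < s" using assms(1)[of 4] that by auto
  consider "s = 0" | "s = 1" | "s = 2" | "s = 3" | "s = 4" | "s = 5"
    using assms(2) by linarith
  then show ?thesis
  proof cases
    case 1 then show ?thesis using assms(3) by (auto simp: lhs_coef_def rhs_coef_def)
  next
    case 2 then show ?thesis using coef_identity_1[of nu a lam "d - nu" q] k0 assms(3) by (simp add: d)
  next
    case 3 then show ?thesis using coef_identity_2[of nu a lam "d - nu" q] k0 k1 assms(3) by (simp add: d)
  next
    case 4 then show ?thesis using coef_identity_3[of nu a lam "d - nu" q] k0 k1 k2 assms(3) by (simp add: d)
  next
    case 5 then show ?thesis using coef_identity_4[of nu a lam "d - nu" q] k0 k1 k2 k3 assms(3) by (simp add: d)
  next
    case 6 then show ?thesis using coef_identity_5[of nu a lam "d - nu" q] k0 k1 k2 k3 k4 assms(3) by (simp add: d)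
  qed
qed

section \<open>The projective quantization intertwines the action with its normal form\<close>

lemma sp_D_add: "sp_D (F + G) = sp_D F + sp_D G"
  by (simp add: sp_D_pair pderiv_add)
lemma sp_D_smult: "sp_D (sp_smult c F) = sp_smult c (sp_D F)"
  by (simp add: sp_D_pair sp_smult_def pderiv_smult)
lemma sp_D_0 [simp]: "sp_D 0 = 0"
  by (simp add: sp_D_pair zero_prod_def)
lemma sp_D_funpow_add: "(sp_D ^^ t) (F + G) = (sp_D ^^ t) F + (sp_D ^^ t) G"
  by (induction t) (auto simp: sp_D_add)
lemma sp_D_funpow_smult: "(sp_D ^^ t) (sp_smult c F) = sp_smult c ((sp_D ^^ t) F)"
  by (induction t) (auto simp: sp_D_smult)
lemma sp_D_funpow_0: "(sp_D ^^ t) 0 = 0"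
  by (induction t) auto
lemma sp_D_funpow_sum: "(sp_D ^^ t) (\<Sum>i\<in>A. f i) = (\<Sum>i\<in>A. (sp_D ^^ t) (f i))"
  by (induction A rule: infinite_finite_induct) (auto simp: sp_D_funpow_add sp_D_funpow_0)

lemma sp_sigma_funpow_add: "(sp_sigma ^^ t) (F + G) = (sp_sigma ^^ t) F + (sp_sigma ^^ t) G"
  by (simp add: sp_sigma_funpow) (simp add: sp_sigma_def)
lemma sp_sigma_funpow_smult: "(sp_sigma ^^ t) (sp_smult c F) = sp_smult c ((sp_sigma ^^ t) F)"
  by (simp add: sp_sigma_funpow) (simp add: sp_sigma_def sp_smult_def)

lemma sp_smult_smult [simp]: "sp_smult c (sp_smult d F) = sp_smult (c * d) F"
  by (simp add: sp_smult_def)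
lemma sp_smult_1 [simp]: "sp_smult 1 F = F"
  by (simp add: sp_smult_def)
lemma sp_smult_add_left: "sp_smult (c + d) F = sp_smult c F + sp_smult d F"
  by (simp add: sp_smult_def smult_add_left)
lemma sp_smult_sum: "sp_smult c (\<Sum>i\<in>A. f i) = (\<Sum>i\<in>A. sp_smult c (f i))"
  by (induction A rule: infinite_finite_induct) (auto simp: sp_smult_add)
lemma sp_smult_sum_left: "sp_smult (\<Sum>i\<in>A. f i) F = (\<Sum>i\<in>A. sp_smult (f i) F)"
  by (induction A rule: infinite_finite_induct) (auto simp: sp_smult_add_left)
lemma sp_mult_smult_right: "sp_mult F (sp_smult c G) = sp_smult c (sp_mult F G)"
  by (simp add: sp_mult_def sp_smult_def smult_add_right)

lemma jet_prod_add: "jet_prod a b F (G + H) = jet_prod a b F G + jet_prod a b F H"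
  by (simp add: jet_prod_def sp_D_funpow_add sp_sigma_funpow_add sp_mult_add)
lemma jet_prod_smult: "jet_prod a b F (sp_smult c G) = sp_smult c (jet_prod a b F G)"
  by (simp add: jet_prod_def sp_D_funpow_smult sp_sigma_funpow_smult sp_mult_smult_right)
lemma jet_prod_0: "jet_prod a b F 0 = 0"
  using jet_prod_smult[of a b F 0 0] by simp
lemma jet_prod_D: "jet_prod a b F ((sp_D ^^ t) G) = jet_prod a (b + t) F G"
  by (simp add: jet_prod_def funpow_add)

text \<open>This is the graded Leibniz rule with the factors swapped: with a single odd variable the
  product commutes without signs. The sign is thereby carried by G, and derivatives of F stay
  untwisted, as in \<open>jet_prod\<close>.\<close>

lemma sp_D_mult: "sp_D (sp_mult F G) = sp_mult F (sp_D G) + sp_mult (sp_D F) (sp_sigma G)"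
  by (simp add: sp_D_pair sp_mult_def sp_sigma_def pderiv_mult algebra_simps)

lemma sp_D_sigma_funpow: "sp_D ((sp_sigma ^^ a) G) = sp_smult ((-1)^a) ((sp_sigma ^^ a) (sp_D G))"
  by (simp add: sp_sigma_funpow) (simp add: sp_sigma_def sp_D_pair sp_smult_def pderiv_minus)

lemma sp_D_N: "sp_D (jet_prod a b F G) = jet_prod (Suc a) b F G + sp_smult ((-1)^a) (jet_prod a (Suc b) F G)"
  by (simp add: jet_prod_def sp_D_mult sp_D_sigma_funpow sp_mult_smult_right)

definition bidiff :: "(nat \<Rightarrow> complex) \<Rightarrow> nat \<Rightarrow> spoly \<Rightarrow> spoly \<Rightarrow> spoly" where
  "bidiff e m F G = (\<Sum>a\<le>m. sp_smult (e a) (jet_prod a (m - a) F G))"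

lemma bidiff_add: "bidiff e m F (G + H) = bidiff e m F G + bidiff e m F H"
  by (simp add: bidiff_def jet_prod_add sp_smult_add sum.distrib)
lemma bidiff_smult: "bidiff e m F (sp_smult c G) = sp_smult c (bidiff e m F G)"
  by (simp add: bidiff_def jet_prod_smult sp_smult_sum mult.commute)
lemma bidiff_0: "bidiff e m F 0 = 0"
  by (simp add: bidiff_def jet_prod_0)
lemma bidiff_scale: "sp_smult c (bidiff e m F G) = bidiff (\<lambda>a. c * e a) m F G"
  by (simp add: bidiff_def sp_smult_sum)
lemma bidiff_plus: "bidiff e m F G + bidiff e' m F G = bidiff (\<lambda>a. e a + e' a) m F G"
  by (simp add: bidiff_def sp_smult_add_left sum.distrib)
lemma bidiff_sum: "(\<Sum>i\<in>A. bidiff (f i) m F G) = bidiff (\<lambda>a. \<Sum>i\<in>A. f i a) m F G"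
  by (simp add: bidiff_def sp_smult_sum_left) (rule sum.swap)
lemma bidiff_cong: "(\<And>a. a \<le> m \<Longrightarrow> e a = e' a) \<Longrightarrow> bidiff e m F G = bidiff e' m F G"
  by (simp add: bidiff_def)

lemma sp_D_sum: "sp_D (\<Sum>i\<in>A. f i) = (\<Sum>i\<in>A. sp_D (f i))"
  using sp_D_funpow_sum[of 1] by simp

lemma sp_D_bidiff: "sp_D (bidiff e m F G) = bidiff (D_coef m e) (Suc m) F G"
proof -
  have "sp_D (bidiff e m F G) = (\<Sum>a\<le>m. sp_smult (e a) (jet_prod (Suc a) (m - a) F G))
      + (\<Sum>a\<le>m. sp_smult ((-1)^a * e a) (jet_prod a (Suc (m - a)) F G))"
    by (simp add: bidiff_def sp_D_sum sp_D_smult sp_D_N sp_smult_add sum.distrib mult.commute)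
  also have "(\<Sum>a\<le>m. sp_smult (e a) (jet_prod (Suc a) (m - a) F G))
      = (\<Sum>a\<le>Suc m. sp_smult (if a = 0 then 0 else e (a - 1)) (jet_prod a (Suc m - a) F G))"
    by (simp add: sum.atMost_Suc_shift del: sum.atMost_Suc)
  also have "(\<Sum>a\<le>m. sp_smult ((-1)^a * e a) (jet_prod a (Suc (m - a)) F G))
      = (\<Sum>a\<le>Suc m. sp_smult (if a \<le> m then (-1)^a * e a else 0) (jet_prod a (Suc m - a) F G))"
    by (simp add: Suc_diff_le)
  finally show ?thesis
    by (simp add: bidiff_def D_coef_def sp_smult_add_left sum.distrib del: sum.atMost_Suc)
qed

lemma sp_D_funpow_bidiff: "(sp_D ^^ t) (bidiff e m F G) = bidiff (D_coef_pow t m e) (m + t) F G"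
  by (induction t) (auto simp: sp_D_bidiff)

lemma dens_eq_bidiff: "dens nu F ((sp_D ^^ s) G) = bidiff (dens_coef nu) (s + 2) F G"
proof -
  have "bidiff (dens_coef nu) (s + 2) F G
      = (\<Sum>a\<in>{0,1,2}. sp_smult (dens_coef nu a) (jet_prod a (s + 2 - a) F G))"
    unfolding bidiff_def by (rule sum.mono_neutral_right) (auto simp: dens_coef_def)
  then show ?thesis by (simp add: dens_def jet_prod_D dens_coef_def add.commute)
qed

lemma dens_add: "dens nu F (G + H) = dens nu F G + dens nu F H"
  and dens_smult: "dens nu F (sp_smult c G) = sp_smult c (dens nu F G)"
  using bidiff_add[of "dens_coef nu" 2 F G H] bidiff_smult[of "dens_coef nu" 2 F c G] dens_eq_bidiff[of nu F 0]
  by (simp_all add: numeral_2_eq_2)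

section \<open>Normal form and quantization\<close>

definition transvec :: "complex \<Rightarrow> nat \<Rightarrow> spoly \<Rightarrow> spoly \<Rightarrow> spoly" where
  "transvec nu s F G = bidiff (transvec_coef nu s) (s + 2) F G"

text \<open>The link scalars S are left arbitrary, so that comparing two normal forms becomes a
  question about two arrays of scalars.\<close>

definition model_act :: "complex \<Rightarrow> (nat \<Rightarrow> nat \<Rightarrow> complex) \<Rightarrow> nat \<Rightarrow> spoly \<Rightarrow> (nat \<Rightarrow> spoly) \<Rightarrow> (nat \<Rightarrow> spoly)" where
  "model_act n S l F T = (\<lambda>j. if j < l then dens (n + of_nat j / 2) F (T j) +
     (\<Sum>i<j. sp_smult (S i (j - i)) (transvec (n + of_nat i / 2) (j - i) F (T i))) else 0)"

definition quant :: "(nat \<Rightarrow> nat \<Rightarrow> complex) \<Rightarrow> nat \<Rightarrow> (nat \<Rightarrow> spoly) \<Rightarrow> (nat \<Rightarrow> spoly)" where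
  "quant c l T = (\<lambda>j. if j < l then (\<Sum>i\<le>j. sp_smult (c i (j - i)) ((sp_D ^^ (j - i)) (T i))) else 0)"

definition quant_coef :: "complex \<Rightarrow> complex \<Rightarrow> bool \<Rightarrow> complex \<Rightarrow> nat \<Rightarrow> nat \<Rightarrow> complex" where
  "quant_coef lam d p n i s = qcoef lam d (p \<noteq> odd i) (n + of_nat i / 2) s"

definition cocycle_coef :: "complex \<Rightarrow> complex \<Rightarrow> bool \<Rightarrow> complex \<Rightarrow> nat \<Rightarrow> nat \<Rightarrow> complex" where
  "cocycle_coef lam d p n i s = cocycle_at lam d (p \<noteq> odd i) (n + of_nat i / 2) s"

lemma D_coef_pow_scale: "D_coef_pow t m (\<lambda>a. c * e a) = (\<lambda>a. c * D_coef_pow t m e a)"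
  by (induction t) (auto simp: D_coef_def algebra_simps)

lemma D_coef_pow_0: "D_coef_pow t m (\<lambda>a. 0) = (\<lambda>a. 0)"
  using D_coef_pow_scale[of t m 0 "\<lambda>_. 0"] by simp

text \<open>Merges the density action (t = 0) with the links, so that a slot of the normal form
  becomes one sum over all source slots up to it.\<close>

definition normal_coef :: "complex \<Rightarrow> complex \<Rightarrow> bool \<Rightarrow> complex \<Rightarrow> nat \<Rightarrow> nat \<Rightarrow> complex" where
  "normal_coef lam d q nu t a = (if t = 0 then dens_coef nu a else cocycle_at lam d q nu t * transvec_coef nu t a)"

text \<open>\<open>cocycle_at\<close> is 0 at t = 1 and t = 2, so only t = 0, 3, 4, 5 survive in the
  sum.\<close>

lemma rhs_coef_alt:
  assumes "s \<le> 5"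
  shows "rhs_coef lam d q nu s a =
    (\<Sum>t\<le>s. qcoef lam d (q \<noteq> odd t) (nu + of_nat t / 2) (s - t) * D_coef_pow (s - t) (t + 2) (normal_coef lam d q nu t) a)"
proof -
  have b: "normal_coef lam d q nu t = (if t = 0 then dens_coef nu else (\<lambda>a. cocycle_at lam d q nu t * transvec_coef nu t a))" for t
    by (auto simp: normal_coef_def)
  have z: "cocycle_at lam d q nu t = 0" if "t = 1 \<or> t = 2" for t
    using that by (auto simp: cocycle_at_def)
  let ?g = "\<lambda>t. qcoef lam d (q \<noteq> odd t) (nu + of_nat t / 2) (s - t) * D_coef_pow (s - t) (t + 2) (normal_coef lam d q nu t) a"
  have "(\<Sum>t\<le>s. ?g t) = (\<Sum>t\<in>{0..5}. if t \<le> s then ?g t else 0)"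
    using assms by (intro sum.mono_neutral_cong_left) auto
  also have "\<dots> = (\<Sum>t\<in>{0,1,2,3,4,5}. if t \<le> s then ?g t else 0)"
    by (intro sum.cong) auto
  also have "\<dots> = ?g 0 + (\<Sum>t\<leftarrow>[3,4,5]. if t \<le> s then ?g t else 0)"
    by (simp add: b z D_coef_pow_scale D_coef_pow_0)
  also have "\<dots> = rhs_coef lam d q nu s a"
    by (simp add: rhs_coef_def b D_coef_pow_scale numeral_2_eq_2)
  finally show ?thesis ..
qed

text \<open>The entry at distance s of action after quantization: G is first quantized into the
  slots t <= s, then X_F carries each of them to slot s.\<close>

lemma entry_lhs:
  "sp_smult (qcoef lam d q nu s) (dens (nu + of_nat s / 2) F ((sp_D ^^ s) G))
    + (\<Sum>t<s. sp_smult (lower_coef lam (2 * (d - nu) - of_nat t) (q \<noteq> odd t) (s - t))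
        (jet_prod (s - t + 2) 0 F (sp_smult (qcoef lam d q nu t) ((sp_D ^^ t) G))))
    = bidiff (lhs_coef lam d q nu s) (s + 2) F G"
proof -
  let ?f = "\<lambda>t. lower_coef lam (2 * (d - nu) - of_nat t) (q \<noteq> odd t) (s - t) * qcoef lam d q nu t"
  let ?e = "\<lambda>a. if 3 \<le> a then ?f (s + 2 - a) else 0"
  have "(\<Sum>t<s. sp_smult (lower_coef lam (2 * (d - nu) - of_nat t) (q \<noteq> odd t) (s - t))
        (jet_prod (s - t + 2) 0 F (sp_smult (qcoef lam d q nu t) ((sp_D ^^ t) G))))
      = (\<Sum>t<s. sp_smult (?f t) (jet_prod (s - t + 2) t F G))"
    by (simp add: jet_prod_smult jet_prod_D)
  also have "\<dots> = (\<Sum>a\<in>{3..s+2}. sp_smult (?f (s + 2 - a)) (jet_prod a (s + 2 - a) F G))"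
    \<comment> \<open>The substitution is a = s + 2 - t, the number of derivatives on F; t < s
      corresponds to 3 <= a <= s + 2.\<close>
    by (rule sum.reindex_bij_witness[of _ "\<lambda>a. s + 2 - a" "\<lambda>t. s + 2 - t"]) (auto simp: Suc_diff_le)
  also have "\<dots> = bidiff ?e (s + 2) F G"
    unfolding bidiff_def by (rule sum.mono_neutral_cong_left) auto
  finally show ?thesis
    unfolding dens_eq_bidiff bidiff_scale
    by (simp only: bidiff_plus) (intro bidiff_cong, auto simp: lhs_coef_def)
qed

lemma entry_rhs:
  assumes "s \<le> 5"
  shows "(\<Sum>t\<le>s. sp_smult (qcoef lam d (q \<noteq> odd t) (nu + of_nat t / 2) (s - t))
      ((sp_D ^^ (s - t)) (bidiff (normal_coef lam d q nu t) (t + 2) F G)))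
    = bidiff (rhs_coef lam d q nu s) (s + 2) F G"
proof -
  have "(\<Sum>t\<le>s. sp_smult (qcoef lam d (q \<noteq> odd t) (nu + of_nat t / 2) (s - t))
      ((sp_D ^^ (s - t)) (bidiff (normal_coef lam d q nu t) (t + 2) F G)))
     = (\<Sum>t\<le>s. bidiff (\<lambda>a. qcoef lam d (q \<noteq> odd t) (nu + of_nat t / 2) (s - t)
          * D_coef_pow (s - t) (t + 2) (normal_coef lam d q nu t) a) (s + 2) F G)"
    by (intro sum.cong refl) (simp add: sp_D_funpow_bidiff bidiff_scale)
  also have "\<dots> = bidiff (rhs_coef lam d q nu s) (s + 2) F G"
    unfolding bidiff_sum by (intro bidiff_cong) (simp only: rhs_coef_alt[OF assms])
  finally show ?thesis .
qed

lemma model_act_alt: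
  assumes "k < l"
  shows "model_act n (cocycle_coef lam d p n) l F T k =
    (\<Sum>i\<le>k. bidiff (normal_coef lam d (p \<noteq> odd i) (n + of_nat i / 2) (k - i)) (k - i + 2) F (T i))"
proof -
  have "{..k} = insert k {..<k}" by auto
  moreover have "normal_coef lam d q nu 0 = dens_coef nu" for q nu by (auto simp: normal_coef_def)
  moreover have "normal_coef lam d q nu t = (\<lambda>a. cocycle_at lam d q nu t * transvec_coef nu t a)" if "t > 0" for q nu t
    using that by (auto simp: normal_coef_def)
  ultimately show ?thesis
    using assms dens_eq_bidiff[of _ F 0]
    by (simp add: model_act_def cocycle_coef_def transvec_def bidiff_scale)
qed

text \<open>Regroups by the source slot i and the distance t from it, because the intertwining
  relation is compared one source slot at a time.\<close>

lemma sum_triangle: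
  fixes f :: "nat \<Rightarrow> nat \<Rightarrow> 'a :: comm_monoid_add"
  shows "(\<Sum>k\<le>j. \<Sum>i\<le>k. f k i) = (\<Sum>i\<le>j. \<Sum>t\<le>j - i. f (i + t) i)"
    "(\<Sum>k<j. \<Sum>i\<le>k. f k i) = (\<Sum>i\<le>j. \<Sum>t<j - i. f (i + t) i)"
  unfolding sum.Sigma[OF finite_atMost ballI[OF finite_atMost]] sum.Sigma[OF finite_lessThan ballI[OF finite_atMost]]
    sum.Sigma[OF finite_atMost ballI[OF finite_lessThan]]
  by (rule sum.reindex_bij_witness[of _ "\<lambda>(i,t). (i + t, i)" "\<lambda>(k,i). (i, k - i)"]; auto)+

text \<open>Both sides are sums over the source slot i of bidifferential operators in F and T i. For
  each i, equality of their coefficients is \<open>coef_identity\<close> with weight n + i/2, parity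
  p + i and s = j - i.\<close>

lemma sq_act_quant:
  assumes n: "\<And>k. k < l \<Longrightarrow> n + of_nat k / 2 \<noteq> 0" and l: "l \<le> 5" and d: "d = mu - lam"
  shows "sq_act lam mu (d - n) p (Suc l) F (quant (quant_coef lam d p n) (Suc l) T)
     = quant (quant_coef lam d p n) (Suc l) (model_act n (cocycle_coef lam d p n) (Suc l) F T)"
proof
  fix j
  show "sq_act lam mu (d - n) p (Suc l) F (quant (quant_coef lam d p n) (Suc l) T) j
     = quant (quant_coef lam d p n) (Suc l) (model_act n (cocycle_coef lam d p n) (Suc l) F T) j"
  proof (cases "j < Suc l")
    case False
    then show ?thesis by (simp add: sq_act_def quant_def)
  next
    case j: True
    let ?q = "\<lambda>i. p \<noteq> odd i" and ?nu = "\<lambda>i. n + of_nat i / 2"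
    let ?c = "\<lambda>i. qcoef lam d (?q i) (?nu i)"
    have nuit: "?nu (i + t) = ?nu i + of_nat t / 2" for i t by (simp add: add_divide_distrib)
    have z: "2 * (d - n) - of_nat (i + t) = 2 * (d - ?nu i) - of_nat t" for i t by (simp add: algebra_simps)
    have q: "?q (i + t) = (?q i \<noteq> odd t)" for i t by auto
    have e0: "mu - lam - (d - n) = n" by (simp add: d)
    have quantk: "quant (quant_coef lam d p n) (Suc l) U k = (\<Sum>i\<le>k. sp_smult (?c i (k - i)) ((sp_D ^^ (k - i)) (U i)))"
      if "k \<le> j" for k U
      using that j by (simp add: quant_def quant_coef_def)
    have dens_sum: "dens nu F (\<Sum>i\<in>A. f i) = (\<Sum>i\<in>A. dens nu F (f i))" for nu f and A :: "nat set"
      using dens_smult[of nu F 0 0]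
      by (induction A rule: infinite_finite_induct) (auto simp: dens_add)
    have N_sum: "jet_prod a b F (\<Sum>i\<in>A. f i) = (\<Sum>i\<in>A. jet_prod a b F (f i))" for a b f and A :: "nat set"
      by (induction A rule: infinite_finite_induct) (auto simp: jet_prod_add jet_prod_0)
    have "sq_act lam mu (d - n) p (Suc l) F (quant (quant_coef lam d p n) (Suc l) T) j
      = dens (?nu j) F (\<Sum>i\<le>j. sp_smult (?c i (j - i)) ((sp_D ^^ (j - i)) (T i)))
        + (\<Sum>k<j. sp_smult (lower_coef lam (2 * (d - n) - of_nat k) (?q k) (j - k))
            (jet_prod (j - k + 2) 0 F (\<Sum>i\<le>k. sp_smult (?c i (k - i)) ((sp_D ^^ (k - i)) (T i)))))"
      unfolding sq_act_formula[OF j] e0 quantk[OF le_refl]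
      by (intro arg_cong2[where f = "(+)"] refl sum.cong) (simp only: quantk less_imp_le lessThan_iff)
    also have "\<dots> = (\<Sum>i\<le>j. sp_smult (?c i (j - i)) (dens (?nu j) F ((sp_D ^^ (j - i)) (T i))))
        + (\<Sum>k<j. \<Sum>i\<le>k. sp_smult (lower_coef lam (2 * (d - n) - of_nat k) (?q k) (j - k))
            (jet_prod (j - k + 2) 0 F (sp_smult (?c i (k - i)) ((sp_D ^^ (k - i)) (T i)))))"
      by (simp only: dens_sum dens_smult N_sum sp_smult_sum)
    also have "\<dots> = (\<Sum>i\<le>j. sp_smult (?c i (j - i)) (dens (?nu j) F ((sp_D ^^ (j - i)) (T i)))
        + (\<Sum>t<j-i. sp_smult (lower_coef lam (2 * (d - n) - of_nat (i + t)) (?q (i + t)) (j - (i + t)))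
            (jet_prod (j - (i + t) + 2) 0 F (sp_smult (?c i (i + t - i)) ((sp_D ^^ (i + t - i)) (T i))))))"
      unfolding sum_triangle(2) sum.distrib ..
    also have "\<dots> = (\<Sum>i\<le>j. bidiff (lhs_coef lam d (?q i) (?nu i) (j - i)) (j - i + 2) F (T i))"
    proof (intro sum.cong refl)
      fix i assume i: "i \<in> {..j}"
      then have nuj: "?nu j = ?nu i + of_nat (j - i) / 2" by (simp add: of_nat_diff field_simps)
      show "sp_smult (?c i (j - i)) (dens (?nu j) F ((sp_D ^^ (j - i)) (T i)))
        + (\<Sum>t<j-i. sp_smult (lower_coef lam (2 * (d - n) - of_nat (i + t)) (?q (i + t)) (j - (i + t)))
            (jet_prod (j - (i + t) + 2) 0 F (sp_smult (?c i (i + t - i)) ((sp_D ^^ (i + t - i)) (T i)))))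
        = bidiff (lhs_coef lam d (?q i) (?nu i) (j - i)) (j - i + 2) F (T i)"
        unfolding entry_lhs[symmetric] nuj z q by simp
    qed
    also have "\<dots> = (\<Sum>i\<le>j. bidiff (rhs_coef lam d (?q i) (?nu i) (j - i)) (j - i + 2) F (T i))"
    proof (intro sum.cong refl bidiff_cong)
      fix i a assume i: "i \<in> {..j}" and a: "a \<le> j - i + 2"
      \<comment> \<open>The weights met on the way from slot i to slot j are n + m/2 with m = i + k
        < j.\<close>
      have "?nu i + of_nat k / 2 \<noteq> 0" if "k < j - i" for k
        using n[of "i + k"] that j by (simp add: add_divide_distrib add.assoc)
      then show "lhs_coef lam d (?q i) (?nu i) (j - i) a = rhs_coef lam d (?q i) (?nu i) (j - i) a"
        using a j l by (intro coef_identity) auto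
    qed
    also have "\<dots> = (\<Sum>i\<le>j. \<Sum>t\<le>j-i. sp_smult (?c (i + t) (j - (i + t)))
       ((sp_D ^^ (j - (i + t))) (bidiff (normal_coef lam d (?q i) (?nu i) (i + t - i)) (i + t - i + 2) F (T i))))"
      by (intro sum.cong refl, subst entry_rhs[symmetric]) (use j l in \<open>simp_all add: q[simplified] add_divide_distrib add.assoc\<close>)
    also have "\<dots> = (\<Sum>k\<le>j. \<Sum>i\<le>k. sp_smult (?c k (j - k)) ((sp_D ^^ (j - k))
        (bidiff (normal_coef lam d (?q i) (?nu i) (k - i)) (k - i + 2) F (T i))))"
      unfolding sum_triangle(1) ..
    also have "\<dots> = (\<Sum>k\<le>j. sp_smult (?c k (j - k)) ((sp_D ^^ (j - k)) (model_act n (cocycle_coef lam d p n) (Suc l) F T k)))"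
      using j by (intro sum.cong refl) (simp only: model_act_alt sp_smult_sum[symmetric] sp_D_funpow_sum[symmetric] atMost_iff order.strict_trans1)
    also have "\<dots> = quant (quant_coef lam d p n) (Suc l) (model_act n (cocycle_coef lam d p n) (Suc l) F T) j"
      by (simp add: quantk)
    finally show ?thesis .
  qed
qed

section \<open>Equivalences of subquotients\<close>

text \<open>The conditions of \<open>SQ_equiv\<close> with the actions left abstract, so that
  subquotients and normal forms can be linked by composing equivalences.\<close>

definition sq_iso :: "nat \<Rightarrow> bool \<Rightarrow> bool \<Rightarrow> (spoly \<Rightarrow> (nat \<Rightarrow> spoly) \<Rightarrow> (nat \<Rightarrow> spoly))
    \<Rightarrow> bool \<Rightarrow> (spoly \<Rightarrow> (nat \<Rightarrow> spoly) \<Rightarrow> (nat \<Rightarrow> spoly)) \<Rightarrow> ((nat \<Rightarrow> spoly) \<Rightarrow> (nat \<Rightarrow> spoly)) \<Rightarrow> bool" where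
  "sq_iso l r p \<rho> p' \<rho>' \<Phi> \<longleftrightarrow>
       bij_betw \<Phi> (sq_carrier l) (sq_carrier l)
     \<and> (\<forall>T\<in>sq_carrier l. \<forall>U\<in>sq_carrier l. \<Phi> (\<lambda>j. T j + U j) = (\<lambda>j. \<Phi> T j + \<Phi> U j))
     \<and> (\<forall>c. \<forall>T\<in>sq_carrier l. \<Phi> (\<lambda>j. sp_smult c (T j)) = (\<lambda>j. sp_smult c (\<Phi> T j)))
     \<and> (\<forall>par. \<forall>T\<in>sq_carrier l. sq_homog p par T \<longrightarrow> sq_homog p' (par \<noteq> r) (\<Phi> T))
     \<and> (\<forall>fpar F. \<forall>T\<in>sq_carrier l. sp_homog fpar F \<longrightarrow>
          \<Phi> (\<rho> F T) = (\<lambda>j. sp_smult (if r \<and> fpar then -1 else 1) (\<rho>' F (\<Phi> T) j)))"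

lemma SQ_equiv_iff_iso:
  "SQ_equiv l lam mu k p lam' mu' k' p' \<longleftrightarrow>
    (\<exists>\<Phi> r. sq_iso l r p (sq_act lam mu k p l) p' (sq_act lam' mu' k' p' l) \<Phi>)"
  unfolding SQ_equiv_def sq_iso_def ..

lemma sq_isoI:
  assumes "bij_betw \<Phi> (sq_carrier l) (sq_carrier l)"
    "\<And>T U. T \<in> sq_carrier l \<Longrightarrow> U \<in> sq_carrier l \<Longrightarrow> \<Phi> (\<lambda>j. T j + U j) = (\<lambda>j. \<Phi> T j + \<Phi> U j)"
    "\<And>c T. T \<in> sq_carrier l \<Longrightarrow> \<Phi> (\<lambda>j. sp_smult c (T j)) = (\<lambda>j. sp_smult c (\<Phi> T j))"
    "\<And>par T. T \<in> sq_carrier l \<Longrightarrow> sq_homog p par T \<Longrightarrow> sq_homog p' (par \<noteq> r) (\<Phi> T)"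
    "\<And>fpar F T. T \<in> sq_carrier l \<Longrightarrow> sp_homog fpar F \<Longrightarrow>
       \<Phi> (\<rho> F T) = (\<lambda>j. sp_smult (if r \<and> fpar then -1 else 1) (\<rho>' F (\<Phi> T) j))"
  shows "sq_iso l r p \<rho> p' \<rho>' \<Phi>"
  unfolding sq_iso_def using assms by blast

lemma sq_isoD:
  assumes "sq_iso l r p \<rho> p' \<rho>' \<Phi>"
  shows "bij_betw \<Phi> (sq_carrier l) (sq_carrier l)"
    and "\<And>T. T \<in> sq_carrier l \<Longrightarrow> \<Phi> T \<in> sq_carrier l"
    and "\<And>T U. T \<in> sq_carrier l \<Longrightarrow> U \<in> sq_carrier l \<Longrightarrow> \<Phi> (\<lambda>j. T j + U j) = (\<lambda>j. \<Phi> T j + \<Phi> U j)"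
    and "\<And>c T. T \<in> sq_carrier l \<Longrightarrow> \<Phi> (\<lambda>j. sp_smult c (T j)) = (\<lambda>j. sp_smult c (\<Phi> T j))"
    and "\<And>par T. T \<in> sq_carrier l \<Longrightarrow> sq_homog p par T \<Longrightarrow> sq_homog p' (par \<noteq> r) (\<Phi> T)"
    and "\<And>fpar F T. T \<in> sq_carrier l \<Longrightarrow> sp_homog fpar F \<Longrightarrow>
       \<Phi> (\<rho> F T) = (\<lambda>j. sp_smult (if r \<and> fpar then -1 else 1) (\<rho>' F (\<Phi> T) j))"
  using assms unfolding sq_iso_def bij_betw_def by blast+

lemma sq_carrier_add: "T \<in> sq_carrier l \<Longrightarrow> U \<in> sq_carrier l \<Longrightarrow> (\<lambda>j. T j + U j) \<in> sq_carrier l"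
  by (simp add: sq_carrier_def)
lemma sq_carrier_smult: "T \<in> sq_carrier l \<Longrightarrow> (\<lambda>j. sp_smult c (T j)) \<in> sq_carrier l"
  by (simp add: sq_carrier_def)
lemma sq_carrier_zero: "(\<lambda>j. 0) \<in> sq_carrier l"
  by (simp add: sq_carrier_def)

lemma sq_iso_zero:
  assumes "sq_iso l r p \<rho> p' \<rho>' \<Phi>"
  shows "\<Phi> (\<lambda>j. 0) = (\<lambda>j. 0)"
  using sq_isoD(4)[OF assms sq_carrier_zero, of 0] by simp

lemma sq_iso_comp:
  assumes f: "sq_iso l r p \<rho> p' \<rho>' \<Phi>" and g: "sq_iso l s p' \<rho>' p'' \<rho>'' \<Psi>"
    and "\<And>F T. T \<in> sq_carrier l \<Longrightarrow> \<rho>' F T \<in> sq_carrier l"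
  shows "sq_iso l (r \<noteq> s) p \<rho> p'' \<rho>'' (\<Psi> \<circ> \<Phi>)"
proof (rule sq_isoI)
  show "bij_betw (\<Psi> \<circ> \<Phi>) (sq_carrier l) (sq_carrier l)"
    by (rule bij_betw_trans[OF sq_isoD(1)[OF f] sq_isoD(1)[OF g]])
next
  fix par T assume "T \<in> sq_carrier l" "sq_homog p par T"
  then have "sq_homog p'' ((par \<noteq> r) \<noteq> s) (\<Psi> (\<Phi> T))"
    by (intro sq_isoD(5)[OF g] sq_isoD(5)[OF f] sq_isoD(2)[OF f])
  moreover have "((par \<noteq> r) \<noteq> s) = (par \<noteq> (r \<noteq> s))" by auto
  ultimately show "sq_homog p'' (par \<noteq> (r \<noteq> s)) ((\<Psi> \<circ> \<Phi>) T)" by simp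
next
  fix fp F T assume T: "T \<in> sq_carrier l" "sp_homog fp F"
  then show "(\<Psi> \<circ> \<Phi>) (\<rho> F T) = (\<lambda>j. sp_smult (if (r \<noteq> s) \<and> fp then - 1 else 1) (\<rho>'' F ((\<Psi> \<circ> \<Phi>) T) j))"
    using sq_isoD(2)[OF f T(1)] assms(3)
    by (auto simp: sq_isoD(6)[OF f T] sq_isoD(4)[OF g] sq_isoD(6)[OF g])
qed (simp_all add: sq_isoD(3,4)[OF f] sq_isoD(3,4)[OF g] sq_isoD(2)[OF f])

lemma sp_homog_diff: "sp_homog b F \<Longrightarrow> sp_homog b G \<Longrightarrow> sp_homog b (F - G)"
  and sp_homog_add: "sp_homog b F \<Longrightarrow> sp_homog b G \<Longrightarrow> sp_homog b (F + G)"
  and sp_homog_smult: "sp_homog b F \<Longrightarrow> sp_homog b (sp_smult c F)"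
  and sp_homog_0: "sp_homog b 0"
  by (auto simp: sp_homog_def sp_smult_def split: if_splits)

lemma sp_homog_both: "sp_homog b F \<Longrightarrow> sp_homog (\<not> b) F \<Longrightarrow> F = 0"
  by (auto simp: sp_homog_def prod_eq_iff split: if_splits)

lemma sp_homog_D: "sp_homog b F \<Longrightarrow> sp_homog (\<not> b) (sp_D F)"
  by (auto simp: sp_homog_def sp_D_pair split: if_splits)

lemma sp_homog_D_funpow: "sp_homog b F \<Longrightarrow> sp_homog (b \<noteq> odd t) ((sp_D ^^ t) F)"
proof (induction t)
  case (Suc t)
  from sp_homog_D[OF Suc.IH[OF Suc.prems]] show ?case by simp
qed simp

lemma sp_homog_sum: "(\<And>i. i \<in> A \<Longrightarrow> sp_homog b (f i)) \<Longrightarrow> sp_homog b (\<Sum>i\<in>A. f i)"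
  by (induction A rule: infinite_finite_induct) (auto intro: sp_homog_add sp_homog_0)

lemma sq_iso_inv:
  assumes f: "sq_iso l r p \<rho> p' \<rho>' \<Phi>"
    and \<rho>: "\<And>F T. T \<in> sq_carrier l \<Longrightarrow> \<rho> F T \<in> sq_carrier l"
  shows "sq_iso l r p' \<rho>' p \<rho> (inv_into (sq_carrier l) \<Phi>)"
proof (rule sq_isoI)
  let ?\<Psi> = "inv_into (sq_carrier l) \<Phi>"
  have inv: "?\<Psi> T = U" if "U \<in> sq_carrier l" "\<Phi> U = T" for T U
    using sq_isoD(1)[OF f] that by (auto simp: bij_betw_def)
  have surj: "\<exists>U\<in>sq_carrier l. \<Phi> U = T" if "T \<in> sq_carrier l" for T
    using sq_isoD(1)[OF f] that unfolding bij_betw_def by (metis imageE)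
  show "bij_betw ?\<Psi> (sq_carrier l) (sq_carrier l)"
    by (rule bij_betw_inv_into[OF sq_isoD(1)[OF f]])
  show "?\<Psi> (\<lambda>j. T j + U j) = (\<lambda>j. ?\<Psi> T j + ?\<Psi> U j)" if T: "T \<in> sq_carrier l" and U: "U \<in> sq_carrier l" for T U
  proof -
    obtain T' U' where *: "T' \<in> sq_carrier l" "\<Phi> T' = T" "U' \<in> sq_carrier l" "\<Phi> U' = U"
      using surj[OF T] surj[OF U] by blast
    show ?thesis
      unfolding inv[OF *(1,2)] inv[OF *(3,4)]
      by (rule inv) (simp_all add: * sq_carrier_add sq_isoD(3)[OF f])
  qed
  show "?\<Psi> (\<lambda>j. sp_smult c (T j)) = (\<lambda>j. sp_smult c (?\<Psi> T j))" if T: "T \<in> sq_carrier l" for T c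
  proof -
    obtain T' where *: "T' \<in> sq_carrier l" "\<Phi> T' = T" using surj[OF T] by blast
    show ?thesis
      unfolding inv[OF *(1,2)] by (rule inv) (simp_all add: * sq_carrier_smult sq_isoD(4)[OF f])
  qed
  show "?\<Psi> (\<rho>' F T) = (\<lambda>j. sp_smult (if r \<and> fp then -1 else 1) (\<rho> F (?\<Psi> T) j))"
    if T: "T \<in> sq_carrier l" and F: "sp_homog fp F" for T fp F
  proof -
    obtain T' where *: "T' \<in> sq_carrier l" "\<Phi> T' = T" using surj[OF T] by blast
    show ?thesis
      unfolding inv[OF *(1,2)]
      by (rule inv) (auto simp: * sq_carrier_smult sq_isoD(4)[OF f] sq_isoD(6)[OF f *(1) F] \<rho>)
  qed
  show "sq_homog p (par \<noteq> r) (?\<Psi> T)" if T: "T \<in> sq_carrier l" and hT: "sq_homog p' par T" for T par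
  proof -
    obtain U where U: "U \<in> sq_carrier l" "\<Phi> U = T" using surj[OF T] by blast
    \<comment> \<open>The parity condition on Phi runs forward only. The preimage U is split into
      parts ?A of the wanted and ?B of the other parity; the image of ?B then has both parities, so
      it is 0, and injectivity gives ?B = 0.\<close>
    define proj where "proj b V j = (if b \<noteq> (p \<noteq> odd j) then (0, snd (V j)) else (fst (V j), 0))"
      for b and V :: "nat \<Rightarrow> spoly" and j :: nat
    let ?A = "proj (par \<noteq> r) U" and ?B = "proj (\<not> (par \<noteq> r)) U"
    have A: "?A \<in> sq_carrier l" "sq_homog p (par \<noteq> r) ?A" and B: "?B \<in> sq_carrier l" "sq_homog p (\<not> (par \<noteq> r)) ?B"
      using U(1) by (auto simp: proj_def sq_carrier_def zero_prod_def sq_homog_def sp_homog_def)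
    have UAB: "U = (\<lambda>j. ?A j + ?B j)" by (auto simp: proj_def prod_eq_iff)
    have hA: "sq_homog p' par (\<Phi> ?A)"
      using sq_isoD(5)[OF f A] by (cases r) auto
    have hB: "sq_homog p' (\<not> par) (\<Phi> ?B)"
      using sq_isoD(5)[OF f B] by (cases r) auto
    have "T = (\<lambda>j. \<Phi> ?A j + \<Phi> ?B j)"
      using sq_isoD(3)[OF f A(1) B(1)] UAB U(2) by simp
    then have TB: "\<Phi> ?B j = T j - \<Phi> ?A j" for j by (simp add: fun_eq_iff)
    have "\<Phi> ?B j = 0" for j
    proof (rule sp_homog_both)
      show "sp_homog (par \<noteq> (p' \<noteq> odd j)) (\<Phi> ?B j)"
        unfolding TB using hT hA by (auto simp: sq_homog_def intro: sp_homog_diff)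
      show "sp_homog (\<not> (par \<noteq> (p' \<noteq> odd j))) (\<Phi> ?B j)"
        using hB[unfolded sq_homog_def, rule_format, of j] by (cases par) auto
    qed
    then have "\<Phi> ?B = \<Phi> (\<lambda>j. 0)" by (auto simp: sq_iso_zero[OF f])
    then have "?B = (\<lambda>j. 0)"
      using sq_isoD(1)[OF f] B(1) sq_carrier_zero by (auto simp: bij_betw_def inj_on_def)
    then have "U = ?A" using UAB by (simp add: fun_eq_iff)
    then show ?thesis unfolding inv[OF U] using A(2) by metis
  qed
qed

section \<open>The quantization as an even equivalence\<close>

lemma quant_add: "quant c l (\<lambda>j. T j + U j) = (\<lambda>j. quant c l T j + quant c l U j)"
  by (auto simp: quant_def sp_D_funpow_add sp_smult_add sum.distrib)

lemma quant_smult: "quant c l (\<lambda>j. sp_smult a (T j)) = (\<lambda>j. sp_smult a (quant c l T j))"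
  by (auto simp: quant_def sp_D_funpow_smult sp_smult_sum mult.commute)

text \<open>The map is triangular in the slots with 1 on the diagonal, so it can be inverted slot by
  slot.\<close>

lemma bij_quant:
  assumes c: "\<And>i. c i 0 = 1"
  shows "bij_betw (quant c l) (sq_carrier l) (sq_carrier l)"
proof (rule bij_betw_imageI)
  have split: "(\<Sum>i\<le>j. sp_smult (c i (j - i)) ((sp_D ^^ (j - i)) (T i)))
      = T j + (\<Sum>i<j. sp_smult (c i (j - i)) ((sp_D ^^ (j - i)) (T i)))" for T j
  proof -
    have "{..j} = insert j {..<j}" by auto
    then show ?thesis by (simp add: c)
  qed
  show "inj_on (quant c l) (sq_carrier l)"
  proof (rule inj_onI)
    fix T U assume T: "T \<in> sq_carrier l" and U: "U \<in> sq_carrier l" and eq: "quant c l T = quant c l U"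
    have "T j = U j" for j
    proof (induction j rule: less_induct)
      case (less j)
      show ?case
      proof (cases "j < l")
        case True
        have "(\<Sum>i<j. sp_smult (c i (j - i)) ((sp_D ^^ (j - i)) (T i)))
           = (\<Sum>i<j. sp_smult (c i (j - i)) ((sp_D ^^ (j - i)) (U i)))"
          using less by (intro sum.cong) auto
        then show ?thesis using fun_cong[OF eq, of j] True by (simp add: quant_def split)
      next
        case False
        then show ?thesis using T U by (simp add: sq_carrier_def)
      qed
    qed
    then show "T = U" by auto
  qed
  show "quant c l ` sq_carrier l = sq_carrier l"
  proof (intro equalityI subsetI)
    fix T assume "T \<in> quant c l ` sq_carrier l"
    then show "T \<in> sq_carrier l" by (auto simp: quant_def sq_carrier_def)
  next
    fix T assume T: "T \<in> sq_carrier l"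
    have "\<exists>U\<in>sq_carrier k. \<forall>j<k. (\<Sum>i\<le>j. sp_smult (c i (j - i)) ((sp_D ^^ (j - i)) (U i))) = T j" for k
    proof (induction k)
      case 0
      show ?case using sq_carrier_zero by auto
    next
      case (Suc k)
      then obtain U where U: "U \<in> sq_carrier k"
        "\<And>j. j < k \<Longrightarrow> (\<Sum>i\<le>j. sp_smult (c i (j - i)) ((sp_D ^^ (j - i)) (U i))) = T j" by blast
      let ?V = "U(k := T k - (\<Sum>i<k. sp_smult (c i (k - i)) ((sp_D ^^ (k - i)) (U i))))"
      have "(\<Sum>i\<le>j. sp_smult (c i (j - i)) ((sp_D ^^ (j - i)) (?V i))) = T j" if "j < Suc k" for j
      proof (cases "j = k")
        case True
        have "(\<Sum>i<k. sp_smult (c i (k - i)) ((sp_D ^^ (k - i)) (?V i)))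
           = (\<Sum>i<k. sp_smult (c i (k - i)) ((sp_D ^^ (k - i)) (U i)))" by (intro sum.cong) auto
        then show ?thesis unfolding True split by simp
      next
        case False
        then have "(\<Sum>i\<le>j. sp_smult (c i (j - i)) ((sp_D ^^ (j - i)) (?V i)))
           = (\<Sum>i\<le>j. sp_smult (c i (j - i)) ((sp_D ^^ (j - i)) (U i)))"
          using that by (intro sum.cong) auto
        then show ?thesis using U(2) that False by simp
      qed
      moreover have "?V \<in> sq_carrier (Suc k)" using U(1) by (auto simp: sq_carrier_def)
      ultimately show ?case by blast
    qed
    then obtain U where U: "U \<in> sq_carrier l"
        "\<And>j. j < l \<Longrightarrow> (\<Sum>i\<le>j. sp_smult (c i (j - i)) ((sp_D ^^ (j - i)) (U i))) = T j" by blast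
    then have "T = quant c l U" using T by (auto simp: quant_def sq_carrier_def)
    then show "T \<in> quant c l ` sq_carrier l" using U(1) by blast
  qed
qed

text \<open>D^(j-i) shifts the parity by j - i, exactly as the parity of Dbar shifts from slot i to
  slot j.\<close>

lemma sq_homog_quant:
  assumes "sq_homog p par T"
  shows "sq_homog p par (quant c l T)"
  unfolding sq_homog_def
proof
  fix j
  have "sp_homog (par \<noteq> (p \<noteq> odd j)) ((sp_D ^^ (j - i)) (T i))" if "i \<le> j" for i
  proof -
    have "sp_homog ((par \<noteq> (p \<noteq> odd i)) \<noteq> odd (j - i)) ((sp_D ^^ (j - i)) (T i))"
      using assms by (intro sp_homog_D_funpow) (simp add: sq_homog_def)
    moreover have "((par \<noteq> (p \<noteq> odd i)) \<noteq> odd (j - i)) = (par \<noteq> (p \<noteq> odd j))" using that by auto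
    ultimately show ?thesis by simp
  qed
  then show "sp_homog (par \<noteq> (p \<noteq> odd j)) (quant c l T j)"
    by (auto simp: quant_def intro!: sp_homog_sum sp_homog_smult sp_homog_0 simp del: not_iff)
qed

lemma model_act_carrier: "model_act n S l F T \<in> sq_carrier l"
  by (simp add: model_act_def sq_carrier_def)
lemma sq_act_carrier: "sq_act lam mu k p l F T \<in> sq_carrier l"
  by (simp add: sq_act_def sq_carrier_def)

lemma quant_iso:
  assumes "\<And>k. k < l \<Longrightarrow> n + of_nat k / 2 \<noteq> 0" and "l \<le> 5"
  shows "sq_iso (Suc l) False p (model_act n (cocycle_coef lam (mu - lam) p n) (Suc l))
     p (sq_act lam mu (mu - lam - n) p (Suc l)) (quant (quant_coef lam (mu - lam) p n) (Suc l))"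
proof (rule sq_isoI)
  show "bij_betw (quant (quant_coef lam (mu - lam) p n) (Suc l)) (sq_carrier (Suc l)) (sq_carrier (Suc l))"
    by (rule bij_quant) (simp add: quant_coef_def)
qed (simp_all add: quant_add quant_smult sq_homog_quant sq_act_quant[OF assms refl])

text \<open>An odd equivalence uses sigma, which anticommutes with the links of odd length; the sign (-1)^j
compensates for this.\<close>
definition twist :: "bool \<Rightarrow> (nat \<Rightarrow> complex) \<Rightarrow> (nat \<Rightarrow> spoly) \<Rightarrow> (nat \<Rightarrow> spoly)" where
  "twist r b T = (\<lambda>j. sp_smult (b j * (if r then (-1)^j else 1)) (if r then sp_sigma (T j) else T j))"

section \<open>Diagonal equivalences twisted by sigma\<close>

lemma sp_sigma_add: "sp_sigma (F + G) = sp_sigma F + sp_sigma G"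
  by (simp add: sp_sigma_def)
lemma sp_sigma_smult: "sp_sigma (sp_smult c F) = sp_smult c (sp_sigma F)"
  by (simp add: sp_sigma_def sp_smult_def)
lemma sp_sigma_0 [simp]: "sp_sigma 0 = 0"
  by (simp add: sp_sigma_def zero_prod_def)
lemma sp_sigma_sum: "sp_sigma (\<Sum>i\<in>A. f i) = (\<Sum>i\<in>A. sp_sigma (f i))"
  by (induction A rule: infinite_finite_induct) (auto simp: sp_sigma_add)

lemma sp_sigma_mult: "sp_sigma (sp_mult F G) = sp_mult (sp_sigma F) (sp_sigma G)"
  by (simp add: sp_sigma_def sp_mult_def)

lemma sp_sigma_D: "sp_sigma (sp_D F) = sp_smult (-1) (sp_D (sp_sigma F))"
  by (simp add: sp_sigma_def sp_D_pair sp_smult_def pderiv_minus)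

lemma sp_sigma_D_funpow: "sp_sigma ((sp_D ^^ a) F) = sp_smult ((-1)^a) ((sp_D ^^ a) (sp_sigma F))"
  by (induction a) (auto simp: sp_sigma_D sp_sigma_smult sp_D_smult)

lemma sp_sigma_homog: "sp_homog fp F \<Longrightarrow> sp_sigma F = sp_smult (if fp then -1 else 1) F"
  by (auto simp: sp_homog_def sp_sigma_def sp_smult_def prod_eq_iff split: if_splits)

lemma sp_mult_smult_left: "sp_mult (sp_smult c F) G = sp_smult c (sp_mult F G)"
  by (simp add: sp_mult_def sp_smult_def smult_add_right)

lemma sp_sigma_N:
  assumes "sp_homog fp F"
  shows "sp_sigma (jet_prod a b F G) = sp_smult ((-1)^(a+b) * (if fp then -1 else 1)) (jet_prod a b F (sp_sigma G))"
proof -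
  have "sp_sigma ((sp_sigma ^^ a) H) = (sp_sigma ^^ a) (sp_sigma H)" for H
    by (metis funpow_swap1)
  then show ?thesis
    by (simp add: jet_prod_def sp_sigma_mult sp_sigma_D_funpow sp_sigma_homog[OF assms] sp_D_funpow_smult
      sp_sigma_funpow_smult sp_mult_smult_left sp_mult_smult_right power_add mult_ac)
qed

text \<open>sigma anticommutes with each of the m factors D, and F, being homogeneous, is an
  eigenvector of sigma.\<close>

lemma sp_sigma_bidiff:
  assumes "sp_homog fp F"
  shows "sp_sigma (bidiff e m F G) = sp_smult ((-1)^m * (if fp then -1 else 1)) (bidiff e m F (sp_sigma G))"
  by (simp add: bidiff_def sp_sigma_sum sp_sigma_smult sp_sigma_N[OF assms] sp_smult_sum mult_ac)

lemma transvec_eq_0: "s \<notin> {3,4,5} \<Longrightarrow> transvec nu s F G = 0"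
  by (simp add: transvec_def bidiff_def transvec_coef_def)

text \<open>When r holds, sigma crosses a link of length s with the sign (-1)^s (-1)^|F|. The first
  factor is absorbed by the signs in \<open>twist\<close>, the second is the one demanded of an odd
  equivalence; what remains is the rescaling condition on b.\<close>

lemma twist_iso:
  assumes r: "r \<longleftrightarrow> p \<noteq> p'" and b: "\<And>j. b j \<noteq> 0"
    and S: "\<And>i s. s \<in> {3,4,5} \<Longrightarrow> i + s < l \<Longrightarrow> b (i + s) * S i s = b i * S' i s"
  shows "sq_iso l r p (model_act n S l) p' (model_act n S' l) (twist r b)"
proof (rule sq_isoI)
  have carrier: "twist r b T \<in> sq_carrier l" if "T \<in> sq_carrier l" for T b
    using that by (auto simp: sq_carrier_def twist_def)
  show "bij_betw (twist r b) (sq_carrier l) (sq_carrier l)"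
  proof (rule bij_betw_byWitness[where f' = "twist r (\<lambda>j. 1 / b j)"])
    have s: "(-1::complex)^j * (-1)^j = 1" for j by (simp flip: power_add)
    show "\<forall>T\<in>sq_carrier l. twist r (\<lambda>j. 1 / b j) (twist r b T) = T"
      "\<forall>T\<in>sq_carrier l. twist r b (twist r (\<lambda>j. 1 / b j) T) = T"
      using b s by (auto simp: twist_def sp_sigma_smult)
  qed (use carrier in auto)
  show "sq_homog p' (par \<noteq> r) (twist r b T)" if "sq_homog p par T" for par T
    unfolding sq_homog_def
  proof
    fix j
    have "sp_homog (par \<noteq> (p \<noteq> odd j)) (twist r b T j)"
      using that[unfolded sq_homog_def, rule_format, of j]
      by (auto simp: twist_def sp_homog_def sp_sigma_def sp_smult_def)
    moreover have "(par \<noteq> (p \<noteq> odd j)) = ((par \<noteq> r) \<noteq> (p' \<noteq> odd j))" using r by auto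
    ultimately show "sp_homog ((par \<noteq> r) \<noteq> (p' \<noteq> odd j)) (twist r b T j)" by simp
  qed
  show "twist r b (model_act n S l F T) = (\<lambda>j. sp_smult (if r \<and> fp then -1 else 1) (model_act n S' l F (twist r b T) j))"
    if F: "sp_homog fp F" for fp F T
  proof
    fix j
    define e where "e = (if r \<and> fp then -1 else 1 :: complex)"
    define t where "t j = b j * (if r then (-1)^j else 1)" for j :: nat
    define \<tau> where "\<tau> G = (if r then sp_sigma G else G)" for G
    have tw: "twist r b U j = sp_smult (t j) (\<tau> (U j))" for U j
      by (simp add: twist_def t_def \<tau>_def)
    have \<tau>: "\<tau> (bidiff c m F G) = sp_smult (e * (if r then (-1)^m else 1)) (bidiff c m F (\<tau> G))" for c m G
      by (simp add: \<tau>_def e_def sp_sigma_bidiff[OF F])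
    have \<tau>add: "\<tau> (G + H) = \<tau> G + \<tau> H" and \<tau>smult: "\<tau> (sp_smult c G) = sp_smult c (\<tau> G)" for c G H
      by (simp_all add: \<tau>_def sp_sigma_add sp_sigma_smult)
    have \<tau>sum: "\<tau> (\<Sum>i\<in>A. f i) = (\<Sum>i\<in>A. \<tau> (f i))" for f and A :: "nat set"
      by (simp add: \<tau>_def sp_sigma_sum)
    have dens: "dens nu F G = bidiff (dens_coef nu) 2 F G" for nu G
      using dens_eq_bidiff[of nu F 0 G] by (simp add: numeral_2_eq_2)
    have "sp_smult (t j) (\<tau> (model_act n S l F T j)) = sp_smult e (model_act n S' l F (twist r b T) j)"
    proof (cases "j < l")
      case True
      have trm: "sp_smult (t j) (\<tau> (sp_smult (S i (j - i)) (transvec nu (j - i) F (T i))))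
         = sp_smult e (sp_smult (S' i (j - i)) (transvec nu (j - i) F (sp_smult (t i) (\<tau> (T i)))))"
        if "i < j" for i nu
      proof (cases "j - i \<in> {3,4,5}")
        case s: True
        have "b j * S i (j - i) = b i * S' i (j - i)" using S[OF s, of i] True that by simp
        moreover have "(-1::complex)^j * (-1)^(j - i) = (-1)^i"
          using that by (cases "even i"; cases "even j") (auto simp: uminus_power_if)
        ultimately have "t j * (S i (j - i) * (if r then (-1)^(j - i) else 1)) = t i * S' i (j - i)"
          unfolding t_def by (auto simp: algebra_simps)
        then have "t j * (S i (j - i) * (e * (if r then (-1)^(j - i + 2) else 1))) = e * (S' i (j - i) * t i)"
          by (auto simp: algebra_simps)
        then show ?thesis
          by (simp only: transvec_def \<tau>smult \<tau> bidiff_smult sp_smult_smult)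
      next
        case False
        then show ?thesis by (simp add: transvec_eq_0 \<tau>_def)
      qed
      show ?thesis
        using True by (simp add: model_act_def \<tau>add \<tau>sum dens \<tau> tw sp_smult_add sp_smult_sum trm bidiff_smult mult_ac
             del: sp_smult_smult) (simp add: mult_ac)
    next
      case False
      then show ?thesis by (simp add: model_act_def \<tau>_def)
    qed
    then show "twist r b (model_act n S l F T) j = sp_smult (if r \<and> fp then -1 else 1) (model_act n S' l F (twist r b T) j)"
      by (simp only: tw e_def)
  qed
qed (auto simp: twist_def sp_smult_add sp_sigma_add sp_sigma_smult mult_ac)

section \<open>Equivalences of the normal form\<close>

definition slot :: "nat \<Rightarrow> spoly \<Rightarrow> nat \<Rightarrow> spoly" where
  "slot i G = (\<lambda>j. if j = i then G else 0)"

definition sp_const :: "complex \<Rightarrow> spoly" where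
  "sp_const c = ([:c:], 0)"

lemma slot_carrier: "i < l \<Longrightarrow> slot i G \<in> sq_carrier l"
  by (simp add: slot_def sq_carrier_def)
lemma slot_smult: "slot i (sp_smult c G) = (\<lambda>j. sp_smult c (slot i G j))"
  by (auto simp: slot_def)

lemma transvec_simps:
  "transvec nu 3 F G = jet_prod 5 0 F G"
  "transvec nu 4 F G = sp_smult (2 * nu) (jet_prod 6 0 F G) + sp_smult 3 (jet_prod 5 1 F G)"
  "transvec nu 5 F G = sp_smult (2 * nu) (jet_prod 7 0 F G) + sp_smult (-1) (jet_prod 6 1 F G) + sp_smult (-3) (jet_prod 5 2 F G)"
proof -
  have "transvec nu 3 F G = (\<Sum>a\<in>{5}. sp_smult (transvec_coef nu 3 a) (jet_prod a (5 - a) F G))"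
    unfolding transvec_def bidiff_def by (rule sum.mono_neutral_cong_right) (auto simp: transvec_coef_def)
  then show "transvec nu 3 F G = jet_prod 5 0 F G" by (simp add: transvec_coef_def)
  have "transvec nu 4 F G = (\<Sum>a\<in>{5,6}. sp_smult (transvec_coef nu 4 a) (jet_prod a (6 - a) F G))"
    unfolding transvec_def bidiff_def by (rule sum.mono_neutral_cong_right) (auto simp: transvec_coef_def)
  then show "transvec nu 4 F G = sp_smult (2 * nu) (jet_prod 6 0 F G) + sp_smult 3 (jet_prod 5 1 F G)"
    by (simp add: transvec_coef_def add.commute)
  have "transvec nu 5 F G = (\<Sum>a\<in>{5,6,7}. sp_smult (transvec_coef nu 5 a) (jet_prod a (7 - a) F G))"
    unfolding transvec_def bidiff_def by (rule sum.mono_neutral_cong_right) (auto simp: transvec_coef_def)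
  then show "transvec nu 5 F G = sp_smult (2 * nu) (jet_prod 7 0 F G) + sp_smult (-1) (jet_prod 6 1 F G) + sp_smult (-3) (jet_prod 5 2 F G)"
    by (simp add: transvec_coef_def add_ac)
qed

lemma jet_prod_const: "jet_prod a b F (sp_const c) = (if b = 0 then sp_smult c ((sp_D ^^ a) F) else 0)"
proof (cases b)
  case 0
  then show ?thesis by (simp add: jet_prod_def sp_sigma_funpow sp_const_def) (simp add: sp_mult_def sp_smult_def sp_sigma_def)
next
  case (Suc b')
  have "sp_D (sp_const c) = 0" by (simp add: sp_const_def sp_D_pair zero_prod_def)
  then have "(sp_D ^^ b) (sp_const c) = 0"
    unfolding Suc by (simp only: funpow_Suc_right o_apply sp_D_funpow_0)
  then show ?thesis using Suc jet_prod_D[of a 0 F b "sp_const c"] by (simp add: jet_prod_0)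
qed

lemma dens_const: "dens nu F (sp_const c) = sp_smult (nu * c) (sp_dx F)"
  using sp_D_funpow_even[of 1 F] by (simp add: dens_def jet_prod_const numeral_2_eq_2)

lemma sp_D_funpow_ge:
  assumes "(sp_D ^^ m) F = 0" "m \<le> a"
  shows "(sp_D ^^ a) F = 0"
proof -
  have "(sp_D ^^ a) F = (sp_D ^^ (a - m)) ((sp_D ^^ m) F)"
    using assms(2) by (simp flip: funpow_add o_apply[of "sp_D ^^ (a - m)"])
  then show ?thesis using assms(1) by (simp add: sp_D_funpow_0)
qed

text \<open>The condition D^5(F) = 0 describes osp(1|2), and every term of a link has at least five
  derivatives on F.\<close>

lemma transvec_projective:
  assumes "(sp_D ^^ 5) F = 0"
  shows "transvec nu s F G = 0"
proof -
  have "jet_prod a b F G = 0" if "a \<ge> 5" for a b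
    using sp_D_funpow_ge[OF assms that] by (simp add: jet_prod_def)
  then show ?thesis
    using transvec_eq_0[of s nu F G] by (cases "s \<in> {3,4,5}") (auto simp: transvec_simps)
qed

lemma model_act_projective:
  assumes "(sp_D ^^ 5) F = 0"
  shows "model_act n S l F T = (\<lambda>j. if j < l then dens (n + of_nat j / 2) F (T j) else 0)"
  by (simp add: model_act_def transvec_projective[OF assms] fun_eq_iff)

text \<open>On a constant only the term with all derivatives on F survives, so a link of length s
  acts through D^(s+2)(F), with the leading coefficient 1, 2 nu or 2 nu of the transvectant.\<close>

lemma model_act_const:
  assumes "j < 6"
  shows "model_act n S 6 F (slot i (sp_const c)) j =
    (if j = i then sp_smult ((n + of_nat i / 2) * c) (sp_dx F)
     else if j = i + 3 then sp_smult (S i 3 * c) ((sp_D ^^ 5) F)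
     else if j = i + 4 then sp_smult (S i 4 * (2 * (n + of_nat i / 2) * c)) ((sp_D ^^ 6) F)
     else if j = i + 5 then sp_smult (S i 5 * (2 * (n + of_nat i / 2) * c)) ((sp_D ^^ 7) F)
     else 0)"
proof -
  have d0: "dens nu F 0 = 0" for nu using dens_smult[of nu F 0 0] by simp
  have t0: "transvec nu s F 0 = 0" for nu s by (simp add: transvec_def bidiff_0)
  have "(\<Sum>i'<j. sp_smult (S i' (j - i')) (transvec (n + of_nat i' / 2) (j - i') F (slot i (sp_const c) i')))
     = (\<Sum>i'<j. if i = i' then sp_smult (S i (j - i)) (transvec (n + of_nat i / 2) (j - i) F (sp_const c)) else 0)"
    by (intro sum.cong refl) (auto simp: slot_def t0)
  also have "\<dots> = (if i < j then sp_smult (S i (j - i)) (transvec (n + of_nat i / 2) (j - i) F (sp_const c)) else 0)"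
    by (simp add: sum.delta)
  finally have eq: "model_act n S 6 F (slot i (sp_const c)) j = dens (n + of_nat j / 2) F (slot i (sp_const c) j)
     + (if i < j then sp_smult (S i (j - i)) (transvec (n + of_nat i / 2) (j - i) F (sp_const c)) else 0)"
    using assms by (simp add: model_act_def)
  show ?thesis
  proof (cases "i < j \<and> j - i \<in> {3,4,5}")
    case True
    then have "j = i + 3 \<or> j = i + 4 \<or> j = i + 5" by auto
    then show ?thesis unfolding eq by (auto simp: slot_def d0 transvec_simps jet_prod_const)
  next
    case False
    then have "\<not> i < j \<or> transvec (n + of_nat i / 2) (j - i) F (sp_const c) = 0" using transvec_eq_0 by blast
    then show ?thesis unfolding eq using False by (auto simp: slot_def d0 dens_const)
  qed
qed

lemma model_act_ge: "\<not> j < l \<Longrightarrow> model_act n S l F T j = 0"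
  by (simp add: model_act_def)

section \<open>Monomial fields and the rigidity of equivalences\<close>

definition xi_pow :: "nat \<Rightarrow> spoly" where "xi_pow k = (0, monom 1 k)"
definition x_pow :: "nat \<Rightarrow> spoly" where "x_pow k = (monom 1 k, 0)"

lemma sp_D_xi: "sp_D (xi_pow k) = x_pow k"
  by (simp add: xi_pow_def x_pow_def sp_D_pair)
lemma sp_D_xx: "sp_D (x_pow k) = sp_smult (of_nat k) (xi_pow (k - 1))"
  by (simp add: xi_pow_def x_pow_def sp_D_pair sp_smult_def pderiv_monom smult_monom)
lemma sp_const_xx: "sp_const c = sp_smult c (x_pow 0)"
  by (simp add: sp_const_def x_pow_def sp_smult_def monom_0)

lemma dens_pair:
  "dens nu F G = (fst F * pderiv (fst G) + smult (1/2) (snd F * snd G) + smult nu (pderiv (fst F) * fst G),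
     snd F * pderiv (fst G) + fst F * pderiv (snd G) + smult (1/2) (pderiv (fst F) * snd G - snd F * pderiv (fst G))
     + smult nu (pderiv (snd F) * fst G + pderiv (fst F) * snd G))"
  by (simp add: dens_def jet_prod_def numeral_2_eq_2 sp_D_pair sp_mult_def sp_sigma_def sp_smult_def smult_add_right algebra_simps)

lemma nonresonant:
  fixes n :: complex
  assumes "n \<notin> {0, -1/2, -1, -3/2, -2}" and "i < 5"
  shows "n + of_nat i / 2 \<noteq> 0"
proof
  assume *: "n + of_nat i / 2 = 0"
  have "i = 0 \<or> i = 1 \<or> i = 2 \<or> i = 3 \<or> i = 4" using assms(2) by linarith
  moreover have "n = - (of_nat i / 2)" using * by (simp add: eq_neg_iff_add_eq_0)
  ultimately show False using assms(1) by auto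
qed

context
  fixes n :: complex and S S' :: "nat \<Rightarrow> nat \<Rightarrow> complex" and p p' r :: bool and \<Phi> and eps :: complex
  assumes iso: "sq_iso 6 r p (model_act n S 6) p' (model_act n S' 6) \<Phi>"
  defines "eps \<equiv> (if r then -1 else 1)"
begin

text \<open>X_xi acts as D/2 in every slot, so its kernel consists of the vectors with constant
  slots, and Phi preserves it. X_x acts on the constants of slot j by n + j/2; these eigenvalues are
  distinct, so the image stays in slot i.\<close>

lemma iso_slot_const:
  assumes i: "i < 6"
  shows "\<exists>b. b \<noteq> 0 \<and> \<Phi> (slot i (sp_const 1)) = slot i (sp_const b)"
proof -
  let ?v = "\<Phi> (slot i (sp_const 1))"
  note v = sq_isoD(2)[OF iso slot_carrier[OF i], of "sp_const 1"]
  have smult_conv: "2 * q = smult 2 q" for q :: "complex poly" by (simp add: numeral_poly)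
  have dens_xi: "dens nu (xi_pow 0) G = sp_smult (1/2) (sp_D G)" for nu G
    by (simp add: dens_pair xi_pow_def sp_smult_def sp_D_pair monom_0) (simp add: poly_eq_iff smult_conv)
  have dens_xx: "dens nu (x_pow 1) (sp_const c) = sp_smult nu (sp_const c)" for nu c
    unfolding dens_const by (simp add: x_pow_def sp_const_def sp_dx_def sp_smult_def pderiv_monom monom_0)
  have D5: "(sp_D ^^ 5) (xi_pow 0) = 0" "(sp_D ^^ 5) (x_pow 1) = 0"
    by (simp_all add: numeral_eq_Suc sp_D_xi sp_D_xx sp_D_smult)
  have "model_act n S 6 (xi_pow 0) (slot i (sp_const 1)) = (\<lambda>j. 0)"
  proof
    fix j
    have "sp_D (slot i (sp_const 1) j) = 0"
      by (simp add: slot_def sp_const_def sp_D_pair zero_prod_def)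
    then show "model_act n S 6 (xi_pow 0) (slot i (sp_const 1)) j = 0"
      by (simp add: model_act_projective[OF D5(1)] dens_xi)
  qed
  then have "(\<lambda>j. sp_smult eps (model_act n S' 6 (xi_pow 0) ?v j)) = (\<lambda>j. 0)"
    using sq_isoD(6)[OF iso slot_carrier[OF i], of True "xi_pow 0" "sp_const 1"] sq_iso_zero[OF iso]
    by (simp add: eps_def sp_homog_def xi_pow_def)
  note v0 = this
  have eps0: "eps \<noteq> 0" by (simp add: eps_def)
  have "sp_smult (eps * (1/2)) (sp_D (?v j)) = 0" if "j < 6" for j
    using fun_cong[OF v0, of j] that by (simp add: model_act_projective[OF D5(1)] dens_xi)
  then have "sp_D (?v j) = 0" if "j < 6" for j
    using that eps0 by (force simp: sp_smult_def prod_eq_iff)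
  then have sp_const: "\<exists>c. ?v j = sp_const c" if "j < 6" for j
    using that by (force simp: sp_D_pair sp_const_def zero_prod_def prod_eq_iff pderiv_eq_0_iff
        elim!: degree_eq_zeroE)
  \<comment> \<open>The eigenvalue equation for X_x, which is transported through Phi to compare the
    slots of ?v.\<close>
  have "model_act n S 6 (x_pow 1) (slot i (sp_const 1)) = (\<lambda>j. sp_smult (n + of_nat i / 2) (slot i (sp_const 1) j))"
    using i dens_smult[of _ "x_pow 1" 0 0] unfolding model_act_projective[OF D5(2)]
    by (auto simp: slot_def dens_xx[unfolded One_nat_def])
  then have *: "(\<lambda>j. sp_smult (n + of_nat i / 2) (?v j)) = model_act n S' 6 (x_pow 1) ?v"
    using sq_isoD(6)[OF iso slot_carrier[OF i], of False "x_pow 1" "sp_const 1"]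
      sq_isoD(4)[OF iso slot_carrier[OF i]]
    by (simp add: sp_homog_def x_pow_def)
  have zero: "?v j = 0" if "j \<noteq> i" for j
  proof (cases "j < 6")
    case True
    obtain c where c: "?v j = sp_const c" using sp_const[OF True] by blast
    have "(n + of_nat i / 2) * c = (n + of_nat j / 2) * c"
      using fun_cong[OF *, of j] True by (simp only: model_act_projective[OF D5(2)] c dens_xx if_True) (simp add: sp_const_def sp_smult_def)
    then have "c = 0" using that by auto
    then show ?thesis using c by (simp add: sp_const_def zero_prod_def)
  next
    case False
    then show ?thesis using v by (simp add: sq_carrier_def)
  qed
  obtain b where b: "?v i = sp_const b" using sp_const[OF i] by blast
  have eq: "?v = slot i (sp_const b)" using zero b by (auto simp: slot_def)
  have "b \<noteq> 0"
  proof
    assume "b = 0"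
    then have "?v = \<Phi> (\<lambda>j. 0)" unfolding eq sq_iso_zero[OF iso] by (auto simp: slot_def sp_const_def zero_prod_def)
    then have "slot i (sp_const 1) = (\<lambda>j. 0)"
      using sq_isoD(1)[OF iso] slot_carrier[OF i] sq_carrier_zero by (auto simp: bij_betw_def inj_on_def)
    then show False by (auto simp: slot_def sp_const_def zero_prod_def fun_eq_iff split: if_splits)
  qed
  then show ?thesis using eq by blast
qed

text \<open>Fields of osp(1|2) act within each slot, so a scalar known on G propagates to L(X_F) G,
  with one factor \<open>eps\<close> for every odd field.\<close>

lemma iso_slot_raise:
  assumes i: "i < 6" and G: "\<Phi> (slot i G) = slot i (sp_smult k G)" and F: "(sp_D ^^ 5) F = 0" "sp_homog fp F"
    and H: "dens (n + of_nat i / 2) F G = sp_smult c H" and c: "c \<noteq> 0"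
  shows "\<Phi> (slot i H) = slot i (sp_smult (k * (if fp then eps else 1)) H)"
proof -
  have act: "model_act n S'' 6 F (slot i (sp_smult k G)) = slot i (sp_smult (k * c) H)" for S'' k
    using i dens_smult[of _ F 0 0] by (auto simp: model_act_projective[OF F(1)] slot_def dens_smult H)
  have "\<Phi> (slot i (sp_smult c H)) = slot i (sp_smult (k * c * (if fp then eps else 1)) H)"
    using sq_isoD(6)[OF iso slot_carrier[OF i] F(2), of G]
    unfolding G act act[of S 1, unfolded sp_smult_1 mult_1] by (auto simp: slot_def eps_def)
  then have "(\<lambda>j. sp_smult c (\<Phi> (slot i H) j)) = slot i (sp_smult (k * c * (if fp then eps else 1)) H)"
    unfolding slot_smult sq_isoD(4)[OF iso slot_carrier[OF i]] .
  then have "sp_smult c (\<Phi> (slot i H) j) = sp_smult c (slot i (sp_smult (k * (if fp then eps else 1)) H) j)" for j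
    by (auto simp: fun_eq_iff slot_def mult_ac)
  then have "sp_smult (1 / c) (sp_smult c (\<Phi> (slot i H) j)) = sp_smult (1 / c) (sp_smult c (slot i (sp_smult (k * (if fp then eps else 1)) H) j))" for j
    by (rule arg_cong)
  then show ?thesis using c by (simp add: fun_eq_iff)
qed

lemma iso_relations:
  assumes n: "n \<notin> {0, -1/2, -1, -3/2, -2}"
  shows "\<exists>b. (\<forall>j. b j \<noteq> 0) \<and> (\<forall>i s. s \<in> {3,4,5} \<longrightarrow> i + s < 6 \<longrightarrow> b (i + s) * S i s = b i * S' i s)"
proof -
  have "\<forall>i. \<exists>b. i < 6 \<longrightarrow> b \<noteq> 0 \<and> \<Phi> (slot i (sp_const 1)) = slot i (sp_const b)"
    using iso_slot_const by blast
  then obtain \<beta> where "\<And>i. i < 6 \<Longrightarrow> \<beta> i \<noteq> 0 \<and> \<Phi> (slot i (sp_const 1)) = slot i (sp_const (\<beta> i))"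
    by metis
  then have \<beta>: "\<beta> i \<noteq> 0" "\<Phi> (slot i (sp_const 1)) = slot i (sp_const (\<beta> i))" if "i < 6" for i
    using that by auto
  have c1: "sp_const 1 = x_pow 0" by (simp add: sp_const_xx)
  have eps2: "eps * eps = 1" "eps \<noteq> 0" by (auto simp: eps_def)
  note nu = nonresonant[OF n]
  have nuS: "2 * (n + of_nat i / 2) + of_nat k \<noteq> 0" if "i + k < 5" for i k
  proof -
    have "2 * (n + of_nat i / 2) + of_nat k = 2 * (n + of_nat (i + k) / 2)" by (simp add: add_divide_distrib)
    then show ?thesis using nu[OF that] by (simp only: mult_eq_0_iff) simp
  qed
  have D5: "(sp_D ^^ 5) (x_pow 2) = 0" "(sp_D ^^ 5) (xi_pow 1) = 0"
    by (simp_all add: numeral_eq_Suc sp_D_xi sp_D_xx sp_D_smult)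
  have hom: "sp_homog False (x_pow k)" "sp_homog True (xi_pow k)" for k
    by (simp_all add: sp_homog_def xi_pow_def x_pow_def)
  \<comment> \<open>A ladder from the constants up to xi x^2, climbed with X_{x^2} and X_{xi x}. Its
    factors are multiples of 2 nu, 2 nu + 1 and 2 nu + 2, hence zero only at excluded weights; this
    fixes the ranges of i in \<open>P1\<close> to \<open>P5\<close>.\<close>
  have dens:
    "dens \<nu> (x_pow 2) (x_pow 0) = sp_smult (2 * \<nu>) (x_pow 1)"
    "dens \<nu> (xi_pow 1) (x_pow 0) = sp_smult \<nu> (xi_pow 0)"
    "dens \<nu> (xi_pow 1) (x_pow 1) = sp_smult ((2 * \<nu> + of_nat 1) / 2) (xi_pow 1)"
    "dens \<nu> (x_pow 2) (x_pow 1) = sp_smult (2 * \<nu> + of_nat 1) (x_pow 2)"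
    "dens \<nu> (x_pow 2) (xi_pow 1) = sp_smult (2 * \<nu> + of_nat 2) (xi_pow 2)" for \<nu>
    by (simp_all add: dens_pair x_pow_def xi_pow_def sp_smult_def pderiv_monom mult_monom smult_monom add_monom diff_monom
       prod_eq_iff numeral_2_eq_2 field_simps)
  have P0: "\<Phi> (slot i (x_pow 0)) = slot i (sp_smult (\<beta> i) (x_pow 0))" if "i < 6" for i
    using \<beta>(2)[OF that] by (simp only: c1) (simp add: sp_const_xx)
  have P1: "\<Phi> (slot i (x_pow 1)) = slot i (sp_smult (\<beta> i) (x_pow 1))" if "i < 5" for i
  proof -
    have i: "i < 6" and c: "2 * (n + of_nat i / 2) \<noteq> 0"
      using that nu[OF that] by (simp_all only: mult_eq_0_iff) simp_all
    from iso_slot_raise[OF i P0[OF i] D5(1) hom(1) dens(1) c] show ?thesis by simp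
  qed
  have P2: "\<Phi> (slot i (xi_pow 0)) = slot i (sp_smult (\<beta> i * eps) (xi_pow 0))" if "i < 5" for i
    using iso_slot_raise[OF _ P0 D5(2) hom(2) dens(2)] that nu[OF that] by simp
  have P3: "\<Phi> (slot i (xi_pow 1)) = slot i (sp_smult (\<beta> i * eps) (xi_pow 1))" if "i < 4" for i
    using iso_slot_raise[OF _ P1 D5(2) hom(2) dens(3)] that nuS[of i 1] by simp
  have P4: "\<Phi> (slot i (x_pow 2)) = slot i (sp_smult (\<beta> i) (x_pow 2))" if "i < 4" for i
    using iso_slot_raise[OF _ P1 D5(1) hom(1) dens(4)] that nuS[of i 1] by simp
  have P5: "\<Phi> (slot i (xi_pow 2)) = slot i (sp_smult (\<beta> i * eps) (xi_pow 2))" if "i < 3" for i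
    using iso_slot_raise[OF _ P3 D5(1) hom(1) dens(5)] that nuS[of i 2] by simp
  have lin: "\<Phi> (slot i (sp_smult c G)) = (\<lambda>j. sp_smult c (\<Phi> (slot i G) j))" if "i < 6" for i c G
    unfolding slot_smult by (rule sq_isoD(4)[OF iso slot_carrier[OF that]])
  \<comment> \<open>xi x^2, x^3 and xi x^3 are chosen so that D^(s+2)(F) is a nonzero constant for s
    = 3, 4, 5 respectively: the longest link then lands on a constant, where Phi is already
    known.\<close>
  have jets: "(sp_D ^^ 5) (xi_pow 2) = sp_smult 2 (x_pow 0)" "(sp_D ^^ 6) (xi_pow 2) = 0" "(sp_D ^^ 7) (xi_pow 2) = 0"
    "(sp_D ^^ 5) (x_pow 3) = sp_smult 6 (xi_pow 0)" "(sp_D ^^ 6) (x_pow 3) = sp_smult 6 (x_pow 0)" "(sp_D ^^ 7) (x_pow 3) = 0"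
    "(sp_D ^^ 5) (xi_pow 3) = sp_smult 6 (x_pow 1)" "(sp_D ^^ 6) (xi_pow 3) = sp_smult 6 (xi_pow 0)" "(sp_D ^^ 7) (xi_pow 3) = sp_smult 6 (x_pow 0)"
    by (simp_all add: numeral_eq_Suc sp_D_xi sp_D_xx sp_D_smult)
  have dx: "sp_dx (xi_pow k) = sp_smult (of_nat k) (xi_pow (k - 1))" "sp_dx (x_pow k) = sp_smult (of_nat k) (x_pow (k - 1))" for k
    by (simp_all add: sp_dx_def xi_pow_def x_pow_def sp_smult_def pderiv_monom smult_monom)
  have xx0: "sp_smult a (x_pow 0) = sp_smult b (x_pow 0) \<Longrightarrow> a = b" for a b
    by (simp add: sp_smult_def x_pow_def smult_monom monom_eq_iff')
  have R3: "\<beta> (i + 3) * S i 3 = eps * \<beta> i * S' i 3" if "i + 3 < 6" for i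
  proof -
    let ?nu = "n + of_nat i / 2"
    have i: "i < 6" using that by simp
    have act: "model_act n S 6 (xi_pow 2) (slot i (sp_const 1))
        = (\<lambda>j. slot i (sp_smult (?nu * 2) (xi_pow 1)) j + slot (i + 3) (sp_smult (S i 3 * 2) (x_pow 0)) j)" (is "_ = ?T")
    proof
      fix j show "model_act n S 6 (xi_pow 2) (slot i (sp_const 1)) j = ?T j"
        using that by (cases "j < 6"; simp only: model_act_const model_act_ge not_False_eq_True if_True) (auto simp: jets dx slot_def)
    qed
    \<comment> \<open>By \<open>P3\<close> the xi x term stays in slot i, so slot i + 3 of the image
      sees only the link.\<close>
    have "\<Phi> (model_act n S 6 (xi_pow 2) (slot i (sp_const 1))) (i + 3) = sp_smult (S i 3 * 2 * \<beta> (i + 3)) (x_pow 0)"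
      unfolding act using that i
      by (simp add: sq_isoD(3)[OF iso] slot_carrier lin P0 P3[unfolded One_nat_def]) (simp add: slot_def)
    moreover have "\<Phi> (model_act n S 6 (xi_pow 2) (slot i (sp_const 1))) (i + 3) = sp_smult (eps * (S' i 3 * \<beta> i * 2)) (x_pow 0)"
      using that by (simp add: sq_isoD(6)[OF iso slot_carrier[OF i] hom(2)] \<beta>(2)[OF i] model_act_const jets eps_def[symmetric])
    ultimately have "S i 3 * 2 * \<beta> (i + 3) = eps * (S' i 3 * \<beta> i * 2)" by (metis xx0)
    then show ?thesis by (simp add: mult_ac)
  qed
  have R4: "\<beta> (i + 4) * S i 4 = \<beta> i * S' i 4" if "i + 4 < 6" for i
  proof -
    let ?nu = "n + of_nat i / 2"
    have i: "i < 6" using that by simp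
    have act: "model_act n S 6 (x_pow 3) (slot i (sp_const 1))
        = (\<lambda>j. slot i (sp_smult (?nu * 3) (x_pow 2)) j + (slot (i + 3) (sp_smult (S i 3 * 6) (xi_pow 0)) j
            + slot (i + 4) (sp_smult (S i 4 * (2 * ?nu) * 6) (x_pow 0)) j))" (is "_ = ?T")
    proof
      fix j show "model_act n S 6 (x_pow 3) (slot i (sp_const 1)) j = ?T j"
        using that by (cases "j < 6"; simp only: model_act_const model_act_ge not_False_eq_True if_True) (auto simp: jets dx slot_def)
    qed
    \<comment> \<open>The link of length 3 is excited as well, but it gives a multiple of xi, which
      stays in slot i + 3 by \<open>P2\<close>; slot i + 4 isolates the link of length 4.\<close>
    have "\<Phi> (model_act n S 6 (x_pow 3) (slot i (sp_const 1))) (i + 4) = sp_smult (S i 4 * (2 * ?nu) * 6 * \<beta> (i + 4)) (x_pow 0)"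
      unfolding act using that i
      by (simp add: sq_isoD(3)[OF iso] sq_carrier_add slot_carrier lin P0 P2 P4) (simp add: slot_def)
    moreover have "\<Phi> (model_act n S 6 (x_pow 3) (slot i (sp_const 1))) (i + 4) = sp_smult (S' i 4 * (2 * ?nu * \<beta> i) * 6) (x_pow 0)"
      using that by (simp add: sq_isoD(6)[OF iso slot_carrier[OF i] hom(1)] \<beta>(2)[OF i] model_act_const jets)
    ultimately have "S i 4 * (2 * ?nu) * 6 * \<beta> (i + 4) = S' i 4 * (2 * ?nu * \<beta> i) * 6" by (metis xx0)
    then have "(12 * ?nu) * (\<beta> (i + 4) * S i 4) = (12 * ?nu) * (\<beta> i * S' i 4)" by algebra
    moreover have "12 * ?nu \<noteq> 0" using nu[of i] that by (simp only: mult_eq_0_iff) simp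
    ultimately show ?thesis using mult_left_cancel by blast
  qed
  have R5: "\<beta> 5 * S 0 5 = eps * \<beta> 0 * S' 0 5"
  proof -
    have act: "model_act n S 6 (xi_pow 3) (slot 0 (sp_const 1))
        = (\<lambda>j. slot 0 (sp_smult (n * 3) (xi_pow 2)) j + (slot 3 (sp_smult (S 0 3 * 6) (x_pow 1)) j
            + (slot 4 (sp_smult (S 0 4 * (2 * n) * 6) (xi_pow 0)) j + slot 5 (sp_smult (S 0 5 * (2 * n) * 6) (x_pow 0)) j)))" (is "_ = ?T")
    proof
      fix j show "model_act n S 6 (xi_pow 3) (slot 0 (sp_const 1)) j = ?T j"
        by (cases "j < 6"; simp only: model_act_const model_act_ge not_False_eq_True if_True) (auto simp: jets dx slot_def)
    qed
    \<comment> \<open>The terms in slots 0, 3 and 4 stay there by \<open>P5\<close>,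
      \<open>P1\<close> and \<open>P2\<close>, which isolates the link of length 5.\<close>
    have "\<Phi> (model_act n S 6 (xi_pow 3) (slot 0 (sp_const 1))) 5 = sp_smult (S 0 5 * (2 * n) * 6 * \<beta> 5) (x_pow 0)"
      unfolding act
      by (simp add: sq_isoD(3)[OF iso] sq_carrier_add slot_carrier lin P0 P1[unfolded One_nat_def] P2 P5) (simp add: slot_def)
    moreover have "\<Phi> (model_act n S 6 (xi_pow 3) (slot 0 (sp_const 1))) 5 = sp_smult (eps * (S' 0 5 * (2 * n * \<beta> 0) * 6)) (x_pow 0)"
      by (simp add: sq_isoD(6)[OF iso slot_carrier hom(2)] \<beta>(2) model_act_const jets eps_def[symmetric])
    ultimately have "S 0 5 * (2 * n) * 6 * \<beta> 5 = eps * (S' 0 5 * (2 * n * \<beta> 0) * 6)" by (metis xx0)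
    then have "(12 * n) * (\<beta> 5 * S 0 5) = (12 * n) * (eps * \<beta> 0 * S' 0 5)" by algebra
    then show ?thesis using nu[of 0] by simp
  qed
  \<comment> \<open>In all three relations the sign is \<open>eps ^ s\<close>, so the factor
    \<open>eps ^ i\<close> absorbs it. Slots from 6 on carry no condition and get the value
    1.\<close>
  define b where "b i = (if i < 6 then eps ^ i * \<beta> i else 1)" for i
  have epspow: "eps ^ k * eps ^ k = 1" for k using eps2(1) by (metis power_mult_distrib power_one)
  have "b (i + s) * S i s = b i * S' i s" if "s \<in> {3,4,5}" "i + s < 6" for i s
  proof -
    have "\<beta> (i + s) * S i s = eps ^ s * \<beta> i * S' i s"
      using R3[of i] R4[of i] R5 that eps2(1) by (auto simp: numeral_eq_Suc)
    then have "b (i + s) * S i s = (eps ^ s * eps ^ s) * (eps ^ i * \<beta> i * S' i s)"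
      using that by (simp add: b_def power_add mult_ac)
    then show ?thesis using that by (simp add: epspow b_def)
  qed
  moreover have "b j \<noteq> 0" for j using \<beta>(1) eps2(2) by (simp add: b_def)
  ultimately show ?thesis by blast
qed

end

section \<open>Classification\<close>

text \<open>Conjugation by the quantizations on both sides moves the question to normal forms, where
  an arbitrary equivalence yields the rescaling relations and any solution of them yields a diagonal
  equivalence.\<close>

lemma SQ_equiv_iff_relations:
  assumes n: "n \<notin> {0, -1/2, -1, -3/2, -2}"
  shows "SQ_equiv 6 lam mu (mu - lam - n) p lam' mu' (mu' - lam' - n) p' \<longleftrightarrow>
    (\<exists>b. (\<forall>j. b j \<noteq> 0) \<and> (\<forall>i s. s \<in> {3,4,5} \<longrightarrow> i + s < 6 \<longrightarrow>
        b (i + s) * cocycle_coef lam (mu - lam) p n i s = b i * cocycle_coef lam' (mu' - lam') p' n i s))"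
    (is "_ \<longleftrightarrow> ?rel")
proof -
  note nu = nonresonant[OF n]
  have Q: "sq_iso 6 False p (model_act n (cocycle_coef lam (mu - lam) p n) 6) p (sq_act lam mu (mu - lam - n) p 6)
      (quant (quant_coef lam (mu - lam) p n) 6)" for p lam mu
    using quant_iso[of 5 n p lam mu, OF nu] by simp
  let ?m = "model_act n (cocycle_coef lam (mu - lam) p n) 6" and ?m' = "model_act n (cocycle_coef lam' (mu' - lam') p' n) 6"
  let ?a = "sq_act lam mu (mu - lam - n) p 6" and ?a' = "sq_act lam' mu' (mu' - lam' - n) p' 6"
  obtain q where q: "sq_iso 6 False p ?m p ?a q" using Q by blast
  obtain q' where q': "sq_iso 6 False p' ?m' p' ?a' q'" using Q by blast
  show ?thesis
  proof
    assume "SQ_equiv 6 lam mu (mu - lam - n) p lam' mu' (mu' - lam' - n) p'"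
    then obtain \<Phi> r where \<Phi>: "sq_iso 6 r p ?a p' ?a' \<Phi>" unfolding SQ_equiv_iff_iso by blast
    have "\<exists>\<Psi> r. sq_iso 6 r p ?m p' ?m' \<Psi>"
      using sq_iso_comp[OF sq_iso_comp[OF q \<Phi> sq_act_carrier] sq_iso_inv[OF q' model_act_carrier] sq_act_carrier] by blast
    then show ?rel using iso_relations[OF _ n] by blast
  next
    assume ?rel
    then obtain b where b: "\<And>j. b j \<noteq> 0" "\<And>i s. s \<in> {3,4,5} \<Longrightarrow> i + s < 6 \<Longrightarrow>
        b (i + s) * cocycle_coef lam (mu - lam) p n i s = b i * cocycle_coef lam' (mu' - lam') p' n i s" by blast
    have "sq_iso 6 (p \<noteq> p') p ?m p' ?m' (twist (p \<noteq> p') b)"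
      by (rule twist_iso) (use b in auto)
    from sq_iso_comp[OF sq_iso_comp[OF sq_iso_inv[OF q model_act_carrier] this model_act_carrier] q' model_act_carrier]
    show "SQ_equiv 6 lam mu (mu - lam - n) p lam' mu' (mu' - lam' - n) p'"
      unfolding SQ_equiv_iff_iso by blast
  qed
qed

lemma edge_cases:
  assumes "s \<in> {3,4,5}" "i + s < (6::nat)"
  obtains "s = 3" "i = 0" | "s = 3" "i = 1" | "s = 3" "i = 2" | "s = 4" "i = 0" | "s = 4" "i = 1" | "s = 5" "i = 0"
proof -
  have "s = 3 \<and> (i = 0 \<or> i = 1 \<or> i = 2) \<or> s = 4 \<and> (i = 0 \<or> i = 1) \<or> s = 5 \<and> i = 0"
    using assms by (simp; linarith)
  then show thesis using that by blast
qed

text \<open>The pairs (i, i + s) are the edges of a graph on {0..5} in which 0 - 4 - 1 - 5 - 0 is the only cycle.\<close>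
lemma relations_iff:
  fixes S S' :: "nat \<Rightarrow> nat \<Rightarrow> complex"
  shows "(\<exists>b. (\<forall>j. b j \<noteq> 0) \<and> (\<forall>i s. s \<in> {3,4,5} \<longrightarrow> i + s < 6 \<longrightarrow> b (i + s) * S i s = b i * S' i s)) \<longleftrightarrow>
    (\<forall>i s. s \<in> {3,4,5} \<longrightarrow> i + s < 6 \<longrightarrow> (S i s = 0 \<longleftrightarrow> S' i s = 0)) \<and>
    (S 0 5 \<noteq> 0 \<and> S 1 3 \<noteq> 0 \<and> S 1 4 \<noteq> 0 \<and> S 0 4 \<noteq> 0 \<longrightarrow>
      S 0 5 * S 1 3 * (S' 1 4 * S' 0 4) = S' 0 5 * S' 1 3 * (S 1 4 * S 0 4))"
  (is "?L \<longleftrightarrow> ?Z \<and> ?C")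
proof
  assume ?L
  then obtain b where b: "\<And>j. b j \<noteq> 0"
    "\<And>i s. s \<in> {3,4,5} \<Longrightarrow> i + s < 6 \<Longrightarrow> b (i + s) * S i s = b i * S' i s" by blast
  have ?Z
  proof (intro allI impI)
    fix i s :: nat assume "s \<in> {3,4,5}" "i + s < 6"
    from b(2)[OF this] show "S i s = 0 \<longleftrightarrow> S' i s = 0" using b(1) by (metis mult_eq_0_iff)
  qed
  moreover have ?C
  proof
    have e: "b 5 * S 0 5 = b 0 * S' 0 5" "b 4 * S 1 3 = b 1 * S' 1 3" "b 5 * S 1 4 = b 1 * S' 1 4" "b 4 * S 0 4 = b 0 * S' 0 4"
      using b(2)[of 5 0] b(2)[of 3 1] b(2)[of 4 1] b(2)[of 4 0] by simp_all
    have "(b 5 * b 4 * b 0 * b 1) * (S 0 5 * S 1 3 * (S' 1 4 * S' 0 4))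
       = (b 5 * S 0 5) * (b 4 * S 1 3) * ((b 1 * S' 1 4) * (b 0 * S' 0 4))" by (simp only: mult_ac)
    also have "\<dots> = (b 0 * S' 0 5) * (b 1 * S' 1 3) * ((b 5 * S 1 4) * (b 4 * S 0 4))" by (simp only: e)
    also have "\<dots> = (b 5 * b 4 * b 0 * b 1) * (S' 0 5 * S' 1 3 * (S 1 4 * S 0 4))" by (simp only: mult_ac)
    finally show "S 0 5 * S 1 3 * (S' 1 4 * S' 0 4) = S' 0 5 * S' 1 3 * (S 1 4 * S 0 4)" using b(1) by simp
  qed
  ultimately show "?Z \<and> ?C" ..
next
  assume *: "?Z \<and> ?C"
  \<comment> \<open>The ratio b (i + s) / b i prescribed by a link; where both scalars vanish the
    link imposes nothing and 1 is as good as any nonzero value.\<close>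
  define R where "R i s = (if S i s = 0 then 1 else S' i s / S i s)" for i s
  have z: "S i s = 0 \<longleftrightarrow> S' i s = 0" if "s \<in> {3,4,5}" "i + s < 6" for i s using * that by blast
  have R: "R i s \<noteq> 0" "R i s * S i s = S' i s" if "s \<in> {3,4,5}" "i + s < 6" for i s
    using z[OF that] by (auto simp: R_def)
  have R0: "R 0 5 \<noteq> 0" "R 0 4 \<noteq> 0" "R 1 3 \<noteq> 0" "R 1 4 \<noteq> 0" "R 0 3 \<noteq> 0" "R 2 3 \<noteq> 0"
    by (rule R(1); simp)+
  \<comment> \<open>The four ratios on the cycle must be compatible around it. If some link of the
    cycle vanishes, its ratio is free and is chosen to close the cycle; otherwise compatibility is
    the cross ratio condition.\<close>
  have "\<exists>r05 r04 r13 r14. r05 \<noteq> 0 \<and> r04 \<noteq> 0 \<and> r13 \<noteq> 0 \<and> r14 \<noteq> 0 \<and> r05 * r13 = r14 * r04 \<and>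
     r05 * S 0 5 = S' 0 5 \<and> r04 * S 0 4 = S' 0 4 \<and> r13 * S 1 3 = S' 1 3 \<and> r14 * S 1 4 = S' 1 4"
  proof -
    consider "S 0 5 = 0" | "S 0 4 = 0" | "S 1 3 = 0" | "S 1 4 = 0" | "S 0 5 \<noteq> 0" "S 0 4 \<noteq> 0" "S 1 3 \<noteq> 0" "S 1 4 \<noteq> 0" by blast
    then show ?thesis
    proof cases
      case 1
      then show ?thesis using z[of 5 0] R0 R
        by (intro exI[of _ "R 1 4 * R 0 4 / R 1 3"] exI[of _ "R 0 4"] exI[of _ "R 1 3"] exI[of _ "R 1 4"]) simp
    next
      case 2
      then show ?thesis using z[of 4 0] R0 R
        by (intro exI[of _ "R 0 5"] exI[of _ "R 0 5 * R 1 3 / R 1 4"] exI[of _ "R 1 3"] exI[of _ "R 1 4"]) simp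
    next
      case 3
      then show ?thesis using z[of 3 1] R0 R
        by (intro exI[of _ "R 0 5"] exI[of _ "R 0 4"] exI[of _ "R 1 4 * R 0 4 / R 0 5"] exI[of _ "R 1 4"]) simp
    next
      case 4
      then show ?thesis using z[of 4 1] R0 R
        by (intro exI[of _ "R 0 5"] exI[of _ "R 0 4"] exI[of _ "R 1 3"] exI[of _ "R 0 5 * R 1 3 / R 0 4"]) simp
    next
      case 5
      then have "R 0 5 * R 1 3 = R 1 4 * R 0 4" using * by (simp add: R_def field_simps)
      then show ?thesis using R0 R
        by (intro exI[of _ "R 0 5"] exI[of _ "R 0 4"] exI[of _ "R 1 3"] exI[of _ "R 1 4"]) simp
    qed
  qed
  then obtain r05 r04 r13 r14 where r: "r05 \<noteq> 0" "r04 \<noteq> 0" "r13 \<noteq> 0" "r14 \<noteq> 0" "r05 * r13 = r14 * r04"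
     "r05 * S 0 5 = S' 0 5" "r04 * S 0 4 = S' 0 4" "r13 * S 1 3 = S' 1 3" "r14 * S 1 4 = S' 1 4" by blast
  \<comment> \<open>Normalizing b 0 = 1 and following 0-3, 0-4, 0-5, 4-1, 5-2 reaches every vertex;
    the remaining edge 1-5 holds because the cycle closes.\<close>
  define b where "b j = (if j = 1 then r04 / r13 else if j = 2 then r05 / R 2 3 else if j = 3 then R 0 3
     else if j = 4 then r04 else if j = 5 then r05 else 1)" for j :: nat
  have "b j \<noteq> 0" for j using r R0 by (simp add: b_def)
  moreover have "b (i + s) * S i s = b i * S' i s" if "s \<in> {3,4,5}" "i + s < 6" for i s
  proof -
    have r05: "r05 = r04 / r13 * r14" using r by (simp add: field_simps)
    show ?thesis
      using that
    proof (cases rule: edge_cases)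
      case 1 then show ?thesis using R(2)[of 3 0] by (simp add: b_def)
    next
      case 2 then show ?thesis using r by (simp add: b_def field_simps)
    next
      case 3 then show ?thesis using R(2)[of 3 2] R0 by (simp add: b_def field_simps)
    next
      case 4 then show ?thesis using r by (simp add: b_def)
    next
      case 5 then show ?thesis using r(3,9) by (simp add: b_def r05 field_simps)
    next
      case 6 then show ?thesis using r by (simp add: b_def)
    qed
  qed
  ultimately show ?L by blast
qed

text \<open>The inverse of the prefactor of \<open>cocycle_at\<close>, with the factors 3 and sqrt 3
  that come from gamma^(1/2) = sqrt 3 h and gamma^(3/2) = 3 sqrt 3 h^3. The last branch is meant for
  s = 5.\<close>

definition kappa :: "bool \<Rightarrow> complex \<Rightarrow> nat \<Rightarrow> complex" where
  "kappa q nu s = (if s = 3 then - (4 * nu + 2) * (if q then 3 else complex_of_real (sqrt 3))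
     else if s = 4 then - (48 * nu * (nu + 3/2))
     else 48 * nu * (nu + 1) * (nu + 2) * (if q then complex_of_real (sqrt 3) else 1))"

lemma falling_simps: "falling x 1 = x" "falling x 2 = x * (x - 1)" "falling x 3 = x * (x - 1) * (x - 2)"
  by (simp_all add: falling_def numeral_eq_Suc)

lemma sqrt3: "complex_of_real (sqrt 3) ^ 2 = 3" "complex_of_real (sqrt 3) ^ 3 = 3 * complex_of_real (sqrt 3)"
  "complex_of_real (sqrt 3) \<noteq> 0"
proof -
  show 2: "complex_of_real (sqrt 3) ^ 2 = 3" by (simp flip: of_real_power)
  show "complex_of_real (sqrt 3) ^ 3 = 3 * complex_of_real (sqrt 3)"
    unfolding 2[symmetric] by (simp add: power3_eq_cube power2_eq_square)
qed simp

text \<open>With nu = n + i/2 and x = d - nu, the falling factorial in \<open>Sf\<close> starts at x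
  if p + i is even and at x - 1/2 otherwise, so it runs through the same linear factors as
  \<open>cocycle_at\<close>.\<close>

lemma Sf_eq_SSf:
  assumes n: "n \<notin> {0, -1/2, -1, -3/2, -2}" and s: "s \<in> {3,4,5}" "i + s < 6"
  shows "kappa (p \<noteq> odd i) (n + of_nat i / 2) s \<noteq> 0"
    "Sf p n (i + s) i (gam12 lam mu) (mu - lam)
      = kappa (p \<noteq> odd i) (n + of_nat i / 2) s * cocycle_coef lam (mu - lam) p n i s"
proof -
  define h where "h = lam + mu - 1/2"
  define d where "d = mu - lam"
  have h: "2 * lam + d - 1/2 = h" "gam12 lam mu = complex_of_real (sqrt 3) * h"
    by (simp_all add: h_def d_def gam12_def)
  have nz: "n \<noteq> 0" "2 * n + 1 \<noteq> 0" "n + 1 \<noteq> 0" "2 * n + 3 \<noteq> 0" "n + 2 \<noteq> 0"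
  proof -
    have "2 * n + 1 = 2 * (n - (-1/2))" "n + 1 = n - (-1)" "2 * n + 3 = 2 * (n - (-3/2))" "n + 2 = n - (-2)" by simp_all
    then show "n \<noteq> 0" "2 * n + 1 \<noteq> 0" "n + 1 \<noteq> 0" "2 * n + 3 \<noteq> 0" "n + 2 \<noteq> 0"
      using n by (simp_all only: mult_eq_0_iff right_minus_eq insert_iff) simp_all
  qed
  note Sf_simps = kappa_def cocycle_coef_def cocycle_at_def Sf_def Bf_def falling_simps falling_simps(1)[unfolded One_nat_def]
    Let_def h(1) power_mult_distrib sqrt3
  have "kappa (p \<noteq> odd i) (n + of_nat i / 2) s \<noteq> 0 \<and>
    Sf p n (i + s) i (complex_of_real (sqrt 3) * h) d = kappa (p \<noteq> odd i) (n + of_nat i / 2) s * cocycle_coef lam d p n i s"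
    using s
  proof (cases rule: edge_cases)
    case 1
    have "- (n * 12) \<noteq> 6" "- (n * 4) \<noteq> 2"
    proof -
      have "2 * n + 1 = 0" if "- (n * 12) = 6"
      proof -
        have "6 * (2 * n + 1) = 6 - - (n * 12)" by simp
        then have "6 * (2 * n + 1) = 0" by (simp only: that diff_self)
        then show ?thesis by (simp only: mult_eq_0_iff) simp
      qed
      then show "- (n * 12) \<noteq> 6" using nz(2) by blast
      have "2 * n + 1 = 0" if "- (n * 4) = 2"
      proof -
        have "2 * (2 * n + 1) = 2 - - (n * 4)" by simp
        then have "2 * (2 * n + 1) = 0" by (simp only: that diff_self)
        then show ?thesis by (simp only: mult_eq_0_iff) simp
      qed
      then show "- (n * 4) \<noteq> 2" using nz(2) by blast
    qed
    then show ?thesis unfolding 1 using nz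
      by (cases p; simp add: Sf_simps; simp add: linear_numeral_eq_0 field_simps)
  next
    case 2
    show ?thesis unfolding 2 using nz
      by (cases p; simp add: Sf_simps; simp add: linear_numeral_eq_0 field_simps)
  next
    case 3
    show ?thesis unfolding 3 using nz
      by (cases p; simp add: Sf_simps; simp add: linear_numeral_eq_0 field_simps)
  next
    case 4
    show ?thesis unfolding 4 using nz
      by (cases p; simp add: Sf_simps; simp add: linear_numeral_eq_0 field_simps)
  next
    case 5
    show ?thesis unfolding 5 using nz
      by (cases p; simp add: Sf_simps; simp add: linear_numeral_eq_0 field_simps)
  next
    case 6
    show ?thesis unfolding 6 using nz
      by (cases p; simp add: Sf_simps; simp add: linear_numeral_eq_0 field_simps)
  qed
  then show "kappa (p \<noteq> odd i) (n + of_nat i / 2) s \<noteq> 0"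
    "Sf p n (i + s) i (gam12 lam mu) (mu - lam)
      = kappa (p \<noteq> odd i) (n + of_nat i / 2) s * cocycle_coef lam (mu - lam) p n i s"
    by (simp_all add: h d_def)
qed

text \<open>The four scalars belong to the links 0-5, 1-4, 1-5, 0-4, the edges of the cycle; the
  cross ratio constrains an equivalence only if none of them vanishes.\<close>

definition cyclevanish :: "bool \<Rightarrow> complex \<Rightarrow> complex \<Rightarrow> complex \<Rightarrow> bool" where
  "cyclevanish p n g d \<longleftrightarrow> Sf p n 5 0 g d = 0 \<or> Sf p n 4 1 g d = 0 \<or> Sf p n 5 1 g d = 0 \<or> Sf p n 4 0 g d = 0"

text \<open>The zeros of the four falling factorials are together 0, 1, 2 for even p and 1/2, 3/2
  for odd p; the other factors are those listed in \<open>Bvanish\<close>.\<close>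

lemma cyclevanish_iff:
  "cyclevanish False n g d \<longleftrightarrow> d - n \<in> {0, 1, 2} \<or> Bvanish False n g d"
  "cyclevanish True n g d \<longleftrightarrow> d - n \<in> {1/2, 3/2} \<or> Bvanish True n g d"
proof -
  define x where "x = d - n"
  show "cyclevanish False n g d \<longleftrightarrow> d - n \<in> {0, 1, 2} \<or> Bvanish False n g d"
    "cyclevanish True n g d \<longleftrightarrow> d - n \<in> {1/2, 3/2} \<or> Bvanish True n g d"
    unfolding cyclevanish_def Bvanish_def Sf_def x_def[symmetric]
    by (auto simp: falling_simps falling_simps(1)[unfolded One_nat_def])
qed

text \<open>The falling factorials cancel in the cross ratio, so I^p_n is the cross ratio of the
  full scalars S^p.\<close>

lemma Ifn_eq_Sf:
  assumes "\<not> cyclevanish p n g d"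
  shows "Ifn p n g d = Sf p n 5 0 g d * Sf p n 4 1 g d / (Sf p n 5 1 g d * Sf p n 4 0 g d)"
  using assms unfolding cyclevanish_def Ifn_def Sf_def
  by (cases p) (simp_all add: falling_simps falling_simps(1)[unfolded One_nat_def])

lemma SVC_6_iff:
  "SVC n 6 p g d p' g' d' \<longleftrightarrow>
    (\<forall>i s. s \<in> {3,4,5} \<longrightarrow> i + s < 6 \<longrightarrow> (Sf p n (i + s) i g d = 0 \<longleftrightarrow> Sf p' n (i + s) i g' d' = 0))"
  (is "_ \<longleftrightarrow> ?R")
proof
  assume *: "SVC n 6 p g d p' g' d'"
  show ?R
  proof (intro allI impI)
    fix i s :: nat assume "s \<in> {3,4,5}" "i + s < 6"
    then show "Sf p n (i + s) i g d = 0 \<longleftrightarrow> Sf p' n (i + s) i g' d' = 0"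
      by (intro *[unfolded SVC_def, rule_format]) auto
  qed
next
  assume *: ?R
  show "SVC n 6 p g d p' g' d'"
    unfolding SVC_def
  proof (intro allI impI)
    fix hi hj :: nat assume h: "hi + 1 \<le> 6 \<and> hj + 3 \<le> hi \<and> hi \<le> hj + 5"
    then have "hi - hj \<in> {3,4,5}" "hj + (hi - hj) < 6" by auto
    from *[rule_format, OF this] h show "Sf p n hi hj g d = 0 \<longleftrightarrow> Sf p' n hi hj g' d' = 0" by simp
  qed
qed

lemma SQ_equiv_iff:
  fixes n lam mu lam' mu' :: complex
  assumes n: "n \<notin> {0, -1/2, -1, -3/2, -2}"
  defines "d \<equiv> mu - lam" and "d' \<equiv> mu' - lam'" and "g \<equiv> gam12 lam mu" and "g' \<equiv> gam12 lam' mu'"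
  shows "SQ_equiv 6 lam mu (d - n) p lam' mu' (d' - n) p' \<longleftrightarrow>
    SVC n 6 p g d p' g' d' \<and>
    (\<not> cyclevanish p n g d \<and> \<not> cyclevanish p' n g' d' \<longrightarrow> Ifn p n g d = Ifn p' n g' d')"
proof -
  define S where "S = cocycle_coef lam d p n"
  define S' where "S' = cocycle_coef lam' d' p' n"
  define k where "k i s = kappa (p \<noteq> odd i) (n + of_nat i / 2) s" for i s
  define k' where "k' i s = kappa (p' \<noteq> odd i) (n + of_nat i / 2) s" for i s
  define t where "t i s = Sf p n (i + s) i g d" for i s
  define t' where "t' i s = Sf p' n (i + s) i g' d'" for i s
  have kS: "k i s \<noteq> 0" "t i s = k i s * S i s" and kS': "k' i s \<noteq> 0" "t' i s = k' i s * S' i s"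
    if "s \<in> {3,4,5}" "i + s < 6" for i s
    using Sf_eq_SSf[OF n that] unfolding k_def k'_def t_def t'_def S_def S'_def d_def d'_def g_def g'_def by simp_all
  \<comment> \<open>The links 0-5 and 1-4 contribute 1 and 3 for p = 0, but sqrt 3 twice for p = 1.
    The product agrees, so passing from the link scalars to S^p multiplies the cross ratio by a
    factor independent of p, and I^0 can be compared with I^1.\<close>
  have kcycle: "k 0 5 * k 1 3 * (k' 1 4 * k' 0 4) = k' 0 5 * k' 1 3 * (k 1 4 * k 0 4)"
  proof -
    have "kappa (q \<noteq> odd (0::nat)) n 5 * kappa (q \<noteq> odd (1::nat)) (n + 1/2) 3
        = 48 * n * (n + 1) * (n + 2) * (- (4 * (n + 1/2) + 2) * 3)" for q
    proof (cases q)
      case True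
      define r where "r = complex_of_real (sqrt 3)"
      have "kappa (q \<noteq> odd (0::nat)) n 5 = 48 * n * (n + 1) * (n + 2) * r"
        "kappa (q \<noteq> odd (1::nat)) (n + 1/2) 3 = - (4 * (n + 1/2) + 2) * r"
        unfolding kappa_def r_def using True by auto
      moreover have "r * r = 3" using sqrt3(1) by (simp add: r_def power2_eq_square)
      ultimately show ?thesis by algebra
    next
      case False
      then show ?thesis unfolding kappa_def by simp
    qed
    from this[of p] this[of p'] have "k 0 5 * k 1 3 = k' 0 5 * k' 1 3"
      unfolding k_def k'_def by simp
    moreover have "k 1 4 = k' 1 4" "k 0 4 = k' 0 4" by (simp_all add: k_def k'_def kappa_def)
    ultimately show ?thesis by simp
  qed
  have zero: "S i s = 0 \<longleftrightarrow> t i s = 0" "S' i s = 0 \<longleftrightarrow> t' i s = 0" if "s \<in> {3,4,5}" "i + s < 6" for i s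
    using kS[OF that] kS'[OF that] by auto
  have cv: "cyclevanish p n g d \<longleftrightarrow> t 0 5 = 0 \<or> t 1 3 = 0 \<or> t 1 4 = 0 \<or> t 0 4 = 0"
    "cyclevanish p' n g' d' \<longleftrightarrow> t' 0 5 = 0 \<or> t' 1 3 = 0 \<or> t' 1 4 = 0 \<or> t' 0 4 = 0"
    by (simp_all add: cyclevanish_def t_def t'_def)
  have I: "Ifn p n g d = Ifn p' n g' d' \<longleftrightarrow> S 0 5 * S 1 3 * (S' 1 4 * S' 0 4) = S' 0 5 * S' 1 3 * (S 1 4 * S 0 4)"
    if nv: "\<not> cyclevanish p n g d" "\<not> cyclevanish p' n g' d'"
  proof -
    have "Ifn p n g d = t 0 5 * t 1 3 / (t 1 4 * t 0 4)" "Ifn p' n g' d' = t' 0 5 * t' 1 3 / (t' 1 4 * t' 0 4)"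
      using Ifn_eq_Sf nv by (simp_all add: t_def t'_def)
    then have "Ifn p n g d = Ifn p' n g' d' \<longleftrightarrow> t 0 5 * t 1 3 * (t' 1 4 * t' 0 4) = t' 0 5 * t' 1 3 * (t 1 4 * t 0 4)"
      using nv by (simp add: cv frac_eq_eq)
    also have "t 0 5 * t 1 3 * (t' 1 4 * t' 0 4)
        = (k 0 5 * k 1 3 * (k' 1 4 * k' 0 4)) * (S 0 5 * S 1 3 * (S' 1 4 * S' 0 4))"
      by (simp add: kS(2) kS'(2) mult_ac)
    also have "t' 0 5 * t' 1 3 * (t 1 4 * t 0 4)
        = (k 0 5 * k 1 3 * (k' 1 4 * k' 0 4)) * (S' 0 5 * S' 1 3 * (S 1 4 * S 0 4))"
      unfolding kcycle by (simp add: kS(2) kS'(2) mult_ac)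
    finally show ?thesis by (simp add: kS(1) kS'(1))
  qed
  have Z: "(\<forall>i s. s \<in> {3,4,5} \<longrightarrow> i + s < 6 \<longrightarrow> (S i s = 0 \<longleftrightarrow> S' i s = 0)) \<longleftrightarrow> SVC n 6 p g d p' g' d'"
    unfolding SVC_6_iff t_def[symmetric] t'_def[symmetric] using zero by blast
  \<comment> \<open>Under the SVC the cycle is free of zeros on one side exactly when it is on the
    other, so the one-sided condition of \<open>relations_iff\<close> matches the two-sided one
    here.\<close>
  have C: "S 0 5 \<noteq> 0 \<and> S 1 3 \<noteq> 0 \<and> S 1 4 \<noteq> 0 \<and> S 0 4 \<noteq> 0 \<longleftrightarrow> \<not> cyclevanish p n g d \<and> \<not> cyclevanish p' n g' d'"
    if "SVC n 6 p g d p' g' d'"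
  proof -
    have "t i s = 0 \<longleftrightarrow> t' i s = 0" if "s \<in> {3,4,5}" "i + s < 6" for i s
      using \<open>SVC n 6 p g d p' g' d'\<close> that unfolding SVC_6_iff t_def[symmetric] t'_def[symmetric] by blast
    then show ?thesis unfolding cv by (auto simp: zero)
  qed
  have "SQ_equiv 6 lam mu (d - n) p lam' mu' (d' - n) p' \<longleftrightarrow>
    (\<forall>i s. s \<in> {3,4,5} \<longrightarrow> i + s < 6 \<longrightarrow> (S i s = 0 \<longleftrightarrow> S' i s = 0)) \<and>
    (S 0 5 \<noteq> 0 \<and> S 1 3 \<noteq> 0 \<and> S 1 4 \<noteq> 0 \<and> S 0 4 \<noteq> 0 \<longrightarrow>
      S 0 5 * S 1 3 * (S' 1 4 * S' 0 4) = S' 0 5 * S' 1 3 * (S 1 4 * S 0 4))"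
    unfolding d_def d'_def SQ_equiv_iff_relations[OF n] S_def S'_def relations_iff ..
  then show ?thesis unfolding Z using C I by blast
qed

theorem theorem4p4:
  fixes n lam mu lam' mu' :: complex and p p' :: bool
  assumes "n \<notin> {0, -1/2, -1, -3/2, -2}"
  defines "d \<equiv> mu - lam" and "d' \<equiv> mu' - lam'"
      and "g \<equiv> gam12 lam mu" and "g' \<equiv> gam12 lam' mu'"
  shows
   "(SQ_equiv 6 lam mu (d - n) p lam' mu' (d' - n) p' \<longrightarrow> SVC n 6 p g d p' g' d')
  \<and> (\<not> p \<and> \<not> p' \<longrightarrow>
      ((d - n \<in> {0, 1, 2} \<or> d' - n \<in> {0, 1, 2} \<or> Bvanish False n g d \<or> Bvanish False n g' d')
         \<longrightarrow> (SVC n 6 p g d p' g' d' \<longrightarrow> SQ_equiv 6 lam mu (d - n) p lam' mu' (d' - n) p'))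
    \<and> (\<not> (d - n \<in> {0, 1, 2} \<or> d' - n \<in> {0, 1, 2} \<or> Bvanish False n g d \<or> Bvanish False n g' d')
         \<longrightarrow> (SQ_equiv 6 lam mu (d - n) p lam' mu' (d' - n) p'
              \<longleftrightarrow> SVC n 6 p g d p' g' d' \<and> Ifn False n g d = Ifn False n g' d')))
  \<and> (p \<and> p' \<longrightarrow>
      ((d - n \<in> {1/2, 3/2} \<or> d' - n \<in> {1/2, 3/2} \<or> Bvanish True n g d \<or> Bvanish True n g' d')
         \<longrightarrow> (SVC n 6 p g d p' g' d' \<longrightarrow> SQ_equiv 6 lam mu (d - n) p lam' mu' (d' - n) p'))
    \<and> (\<not> (d - n \<in> {1/2, 3/2} \<or> d' - n \<in> {1/2, 3/2} \<or> Bvanish True n g d \<or> Bvanish True n g' d')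
         \<longrightarrow> (SQ_equiv 6 lam mu (d - n) p lam' mu' (d' - n) p'
              \<longleftrightarrow> SVC n 6 p g d p' g' d' \<and> Ifn True n g d = Ifn True n g' d')))
  \<and> (\<not> p \<and> p' \<longrightarrow>
      ((\<exists>(hi, hj) \<in> {(5, 0), (4, 1), (5, 1), (4, 0)}. Sf False n hi hj g d = 0 \<or> Sf True n hi hj g' d' = 0)
         \<longrightarrow> (SVC n 6 p g d p' g' d' \<longrightarrow> SQ_equiv 6 lam mu (d - n) p lam' mu' (d' - n) p'))
    \<and> (\<not> (\<exists>(hi, hj) \<in> {(5, 0), (4, 1), (5, 1), (4, 0)}. Sf False n hi hj g d = 0 \<or> Sf True n hi hj g' d' = 0)
         \<longrightarrow> (SQ_equiv 6 lam mu (d - n) p lam' mu' (d' - n) p'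
              \<longleftrightarrow> SVC n 6 p g d p' g' d' \<and> Ifn False n g d = Ifn True n g' d')))"
proof -
  note E = SQ_equiv_iff[OF assms(1), where lam = lam and mu = mu and lam' = lam' and mu' = mu', folded d_def d'_def g_def g'_def]
  have V: "(\<exists>(hi, hj) \<in> {(5, 0), (4, 1), (5, 1), (4, 0)}. Sf False n hi hj g d = 0 \<or> Sf True n hi hj g' d' = 0)
     \<longleftrightarrow> cyclevanish False n g d \<or> cyclevanish True n g' d'"
    unfolding cyclevanish_def by auto
  have V0: "d - n \<in> {0, 1, 2} \<or> d' - n \<in> {0, 1, 2} \<or> Bvanish False n g d \<or> Bvanish False n g' d'
      \<longleftrightarrow> cyclevanish False n g d \<or> cyclevanish False n g' d'"
    unfolding cyclevanish_iff by blast
  have V1: "d - n \<in> {1/2, 3/2} \<or> d' - n \<in> {1/2, 3/2} \<or> Bvanish True n g d \<or> Bvanish True n g' d'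
      \<longleftrightarrow> cyclevanish True n g d \<or> cyclevanish True n g' d'"
    unfolding cyclevanish_iff by blast
  show ?thesis
    unfolding E V V0 V1 by (cases p; cases p') auto
qed

end
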